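(* Let $q\in(0,1)$, let $\pi:\mathcal{A}\to\mathcal{L}(L_2(h))$ be the representation of $\mathcal{A}=C(SU_q(2))$ by left multiplication on the $L_2$ space of the Haar state $h$, and let $D$ be the equivariant Dirac operator on $L_2(h)$. Suppose $T\in\pi(\mathcal{A})'$ (the commutant of $\pi(\mathcal{A})$ in $\mathcal{L}(L_2(h))$). If $[D,T]$ is bounded, then $T$ is a scalar multiple of the identity.
   Context: Fix $q\in(0,1)$. $\mathcal{A}=C(SU_q(2))$ is the universal $C^*$-algebra generated by $\alpha,\beta$ subject to $\alpha^*\alpha+\beta^*\beta=I=\alpha\alpha^*+q^2\beta\beta^*$, $\alpha\beta=q\beta\alpha$, $\alpha\beta^*=q\beta^*\alpha$, $\beta^*\beta=\beta\beta^*$. $h$ is its Haar state, $L_2(h)$ the GNS Hilbert space, $\pi$ the representation by left multiplication. With $\mathbb{N}=\{0,1,2,\ldots\}$, $L_2(h)$ has a canonical orthonormal basis $\{e^{(n)}_{ij}: n\in\frac12\mathbb{N},\ i,j\in\{-n,-n+1,\ldots,n\}\}$ (normalized matrix entries of the irreducible representations; $e^{(0)}_{00}$ is the class of $1$), in which $$\pi(\alpha)e^{(n)}_{ij}=a_+(n,i,j)e^{(n+1/2)}_{i-1/2,j-1/2}+a_-(n,i,j)e^{(n-1/2)}_{i-1/2,j-1/2},$$ $$\pi(\beta)e^{(n)}_{ij}=b_+(n,i,j)e^{(n+1/2)}_{i+1/2,j-1/2}+b_-(n,i,j)e^{(n-1/2)}_{i+1/2,j-1/2},$$ where (terms whose basis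 vector does not exist being read as $0$) $$a_+=\Bigl(q^{2(n+i)+2(n+j)+2}\tfrac{(1-q^{2n-2j+2})(1-q^{2n-2i+2})}{(1-q^{4n+2})(1-q^{4n+4})}\Bigr)^{1/2},\quad a_-=\Bigl(\tfrac{(1-q^{2n+2j})(1-q^{2n+2i})}{(1-q^{4n})(1-q^{4n+2})}\Bigr)^{1/2},$$ $$b_+=-\Bigl(q^{2(n+j)}\tfrac{(1-q^{2n-2j+2})(1-q^{2n+2i+2})}{(1-q^{4n+2})(1-q^{4n+4})}\Bigr)^{1/2},\quad b_-=\Bigl(q^{2(n+i)}\tfrac{(1-q^{2n+2j})(1-q^{2n-2i})}{(1-q^{4n})(1-q^{4n+2})}\Bigr)^{1/2}.$$ The equivariant Dirac operator is the self-adjoint operator $D$ diagonal in this basis, $De^{(n)}_{ij}=d(n,i)e^{(n)}_{ij}$, with $d(n,i)=2n+1$ if $i\neq n$ and $d(n,i)=-(2n+1)$ if $i=n$. *)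

theory Defs
  imports "HOL-Analysis.Analysis" "HOL-Library.Nonpos_Ints"
begin

section \<open>Complex Hilbert spaces and unital C*-algebras\<close>

class complex_vector = real_vector +
  fixes scaleC :: "complex \<Rightarrow> 'a \<Rightarrow> 'a" (infixr \<open>*\<^sub>C\<close> 75)
  assumes scaleC_add_right: "c *\<^sub>C (x + y) = c *\<^sub>C x + c *\<^sub>C y"
    and scaleC_add_left: "(c + d) *\<^sub>C x = c *\<^sub>C x + d *\<^sub>C x"
    and scaleC_scaleC: "c *\<^sub>C d *\<^sub>C x = (c * d) *\<^sub>C x"
    and scaleC_of_real: "complex_of_real r *\<^sub>C x = r *\<^sub>R x"

text \<open>The complex inner product is conjugate linear in the first argument; the real inner product
  of the library is its real part, so that \<open>norm\<close>, \<open>closure\<close>, \<open>bounded_linear\<close> etc. are those of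
  the Hilbert norm.\<close>

class chilbert_space = complex_vector + real_inner + complete_space +
  fixes cinner :: "'a \<Rightarrow> 'a \<Rightarrow> complex"
  assumes cinner_commute: "cinner x y = cnj (cinner y x)"
    and cinner_add_right: "cinner x (y + z) = cinner x y + cinner x z"
    and cinner_scaleC_right: "cinner x (c *\<^sub>C y) = c * cinner x y"
    and Re_cinner: "Re (cinner x y) = inner x y"
begin

subclass banach ..

end

class cstar_algebra = complex_vector + real_normed_algebra_1 + complete_space +
  fixes star :: "'a \<Rightarrow> 'a"
  assumes scaleC_mult_left: "(c *\<^sub>C x) * y = c *\<^sub>C (x * y)"
    and scaleC_mult_right: "x * (c *\<^sub>C y) = c *\<^sub>C (x * y)"
    and norm_scaleC: "norm (c *\<^sub>C x) = cmod c * norm x"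
    and star_star: "star (star x) = x"
    and star_add: "star (x + y) = star x + star y"
    and star_scaleC: "star (c *\<^sub>C x) = cnj c *\<^sub>C star x"
    and star_mult: "star (x * y) = star y * star x"
    and cstar_identity: "norm (star x * x) = (norm x)\<^sup>2"
begin

subclass banach ..

end

definition clinear :: "('a::complex_vector \<Rightarrow> 'b::complex_vector) \<Rightarrow> bool" where
  "clinear f \<longleftrightarrow> (\<forall>x y. f (x + y) = f x + f y) \<and> (\<forall>c x. f (c *\<^sub>C x) = c *\<^sub>C f x)"

definition bounded_clinear :: "('a::chilbert_space \<Rightarrow> 'b::chilbert_space) \<Rightarrow> bool" where
  "bounded_clinear f \<longleftrightarrow> clinear f \<and> bounded_linear f"

definition is_adjoint :: "('a::chilbert_space \<Rightarrow> 'a) \<Rightarrow> ('a \<Rightarrow> 'a) \<Rightarrow> bool" where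
  "is_adjoint A B \<longleftrightarrow> (\<forall>x y. cinner (A x) y = cinner x (B y))"

definition star_representation :: "('a::cstar_algebra \<Rightarrow> 'h::chilbert_space \<Rightarrow> 'h) \<Rightarrow> bool" where
  "star_representation \<pi> \<longleftrightarrow>
     (\<forall>a. bounded_clinear (\<pi> a)) \<and>
     (\<forall>a b x. \<pi> (a + b) x = \<pi> a x + \<pi> b x) \<and>
     (\<forall>c a x. \<pi> (c *\<^sub>C a) x = c *\<^sub>C \<pi> a x) \<and>
     (\<forall>a b. \<pi> (a * b) = \<pi> a \<circ> \<pi> b) \<and>
     \<pi> 1 = id \<and>
     (\<forall>a. is_adjoint (\<pi> a) (\<pi> (star a)))"

definition star_subalgebra :: "'a::cstar_algebra set \<Rightarrow> bool" where
  "star_subalgebra S \<longleftrightarrow> 1 \<in> S \<and>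
     (\<forall>x\<in>S. \<forall>y\<in>S. x + y \<in> S \<and> x * y \<in> S) \<and>
     (\<forall>x\<in>S. star x \<in> S \<and> (\<forall>c. c *\<^sub>C x \<in> S))"

definition state :: "('a::cstar_algebra \<Rightarrow> complex) \<Rightarrow> bool" where
  "state h \<longleftrightarrow> (\<forall>a b. h (a + b) = h a + h b) \<and> (\<forall>c a. h (c *\<^sub>C a) = c * h a) \<and>
     (\<forall>a. h (star a * a) \<in> \<real>\<^sub>\<ge>\<^sub>0) \<and> h 1 = 1"

text \<open>GNS space of a state: the closure of the image of \<open>\<Lambda>\<close>, where \<open>\<Lambda> a\<close> is the class of \<open>a\<close>,
  with the algebra acting by left multiplication.\<close>

definition gns ::
    "('a::cstar_algebra \<Rightarrow> complex) \<Rightarrow> ('a \<Rightarrow> 'h::chilbert_space \<Rightarrow> 'h) \<Rightarrow> ('a \<Rightarrow> 'h) \<Rightarrow> bool" where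
  "gns h \<pi> \<Lambda> \<longleftrightarrow>
     clinear \<Lambda> \<and>
     closure (range \<Lambda>) = UNIV \<and>
     (\<forall>a b. cinner (\<Lambda> a) (\<Lambda> b) = h (star a * b)) \<and>
     star_representation \<pi> \<and>
     (\<forall>a b. \<pi> a (\<Lambda> b) = \<Lambda> (a * b))"

definition commutant :: "('h::chilbert_space \<Rightarrow> 'h) set \<Rightarrow> ('h \<Rightarrow> 'h) set" where
  "commutant S = {T. bounded_clinear T \<and> (\<forall>A\<in>S. T \<circ> A = A \<circ> T)}"


section \<open>The Hilbert space of square-summable sequences\<close>

typedef ell2 = "{x :: nat \<Rightarrow> complex. summable (\<lambda>n. (cmod (x n))\<^sup>2)}"
  morphisms coord Abs_ell2
  by (rule exI[of _ "\<lambda>_. 0"]) simp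

setup_lifting type_definition_ell2

lemma ell2_add:
  assumes "summable (\<lambda>n. (cmod (x n))\<^sup>2)" "summable (\<lambda>n. (cmod (y n))\<^sup>2)"
  shows "summable (\<lambda>n. (cmod (x n + y n))\<^sup>2)"
proof (rule summable_comparison_test'[of "\<lambda>n. 2 * (cmod (x n))\<^sup>2 + 2 * (cmod (y n))\<^sup>2" 0])
  show "summable (\<lambda>n. 2 * (cmod (x n))\<^sup>2 + 2 * (cmod (y n))\<^sup>2)"
    using assms by (intro summable_add summable_mult)
next
  fix n
  have "(cmod (x n + y n))\<^sup>2 \<le> (cmod (x n) + cmod (y n))\<^sup>2"
    by (intro power_mono norm_triangle_ineq norm_ge_zero)
  also have "\<dots> \<le> 2 * (cmod (x n))\<^sup>2 + 2 * (cmod (y n))\<^sup>2"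
    using sum_squares_bound[of "cmod (x n)" "cmod (y n)"] by (simp add: power2_sum)
  finally show "norm ((cmod (x n + y n))\<^sup>2) \<le> 2 * (cmod (x n))\<^sup>2 + 2 * (cmod (y n))\<^sup>2"
    by simp
qed

lemma ell2_scale:
  assumes "summable (\<lambda>n. (cmod (x n))\<^sup>2)"
  shows "summable (\<lambda>n. (cmod (c * x n))\<^sup>2)"
  using summable_mult[OF assms, of "(cmod c)\<^sup>2"] by (simp add: norm_mult power_mult_distrib)

lemma ell2_mult:
  assumes "summable (\<lambda>n. (cmod (x n))\<^sup>2)" "summable (\<lambda>n. (cmod (y n))\<^sup>2)"
  shows "summable (\<lambda>n. cnj (x n) * y n)"
proof (rule summable_comparison_test'[of "\<lambda>n. (cmod (x n))\<^sup>2 + (cmod (y n))\<^sup>2" 0])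
  show "summable (\<lambda>n. (cmod (x n))\<^sup>2 + (cmod (y n))\<^sup>2)"
    using assms by (rule summable_add)
next
  fix n
  have "2 * (cmod (x n) * cmod (y n)) \<le> (cmod (x n))\<^sup>2 + (cmod (y n))\<^sup>2"
    using sum_squares_bound[of "cmod (x n)" "cmod (y n)"] by simp
  moreover have "0 \<le> cmod (x n) * cmod (y n)" by simp
  ultimately show "norm (cnj (x n) * y n) \<le> (cmod (x n))\<^sup>2 + (cmod (y n))\<^sup>2"
    by (simp only: norm_mult complex_mod_cnj)
qed

lemma coord_summable: "summable (\<lambda>n. (cmod (coord x n))\<^sup>2)"
  using coord[of x] by simp

lemma coord_mult_summable: "summable (\<lambda>n. cnj (coord x n) * coord y n)"
  by (rule ell2_mult[OF coord_summable coord_summable])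

instantiation ell2 :: complex_vector
begin

lift_definition zero_ell2 :: ell2 is "\<lambda>_. 0" by simp
lift_definition plus_ell2 :: "ell2 \<Rightarrow> ell2 \<Rightarrow> ell2" is "\<lambda>x y n. x n + y n" by (rule ell2_add)
lift_definition uminus_ell2 :: "ell2 \<Rightarrow> ell2" is "\<lambda>x n. - x n" by simp
definition minus_ell2 :: "ell2 \<Rightarrow> ell2 \<Rightarrow> ell2" where "minus_ell2 x y = x + (- y)"
lift_definition scaleC_ell2 :: "complex \<Rightarrow> ell2 \<Rightarrow> ell2" is "\<lambda>c x n. c * x n" by (rule ell2_scale)
definition scaleR_ell2 :: "real \<Rightarrow> ell2 \<Rightarrow> ell2" where "scaleR_ell2 r x = complex_of_real r *\<^sub>C x"

instance
  by standard
    (unfold minus_ell2_def scaleR_ell2_def, (transfer; auto simp: algebra_simps)+)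

end

lemma coord_zero [simp]: "coord 0 n = 0"
  by (simp add: zero_ell2.rep_eq)

lemma coord_add [simp]: "coord (x + y) n = coord x n + coord y n"
  by (simp add: plus_ell2.rep_eq)

lemma coord_scaleC [simp]: "coord (c *\<^sub>C x) n = c * coord x n"
  by (simp add: scaleC_ell2.rep_eq)

lemma coord_scaleR [simp]: "coord (r *\<^sub>R x) n = complex_of_real r * coord x n"
  by (simp add: scaleR_ell2_def)

lemma coord_minus [simp]: "coord (x - y) n = coord x n - coord y n"
  unfolding minus_ell2_def coord_add uminus_ell2.rep_eq by (rule add_uminus_conv_diff)

lemma ell2_eqI: "(\<And>n. coord x n = coord y n) \<Longrightarrow> x = y"
  by (rule coord_inject[THEN iffD1]) (rule ext)

instantiation ell2 :: real_inner
begin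

definition inner_ell2 :: "ell2 \<Rightarrow> ell2 \<Rightarrow> real" where
  "inner_ell2 x y = Re (\<Sum>n. cnj (coord x n) * coord y n)"
definition norm_ell2 :: "ell2 \<Rightarrow> real" where "norm_ell2 x = sqrt (inner x x)"
definition sgn_ell2 :: "ell2 \<Rightarrow> ell2" where "sgn_ell2 x = x /\<^sub>R norm x"
definition dist_ell2 :: "ell2 \<Rightarrow> ell2 \<Rightarrow> real" where "dist_ell2 x y = norm (x - y)"
definition uniformity_ell2 :: "(ell2 \<times> ell2) filter" where
  "uniformity_ell2 = (INF e\<in>{0<..}. principal {(x, y). dist x y < e})"
definition open_ell2 :: "ell2 set \<Rightarrow> bool" where
  "open_ell2 U = (\<forall>x\<in>U. eventually (\<lambda>(x', y). x' = x \<longrightarrow> y \<in> U) uniformity)"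

lemma inner_ell2_eq: "inner x y = (\<Sum>n. Re (cnj (coord x n) * coord y n))" for x y :: ell2
  unfolding inner_ell2_def by (simp only: Re_suminf[OF coord_mult_summable])

lemma inner_ell2_self: "inner x x = (\<Sum>n. (cmod (coord x n))\<^sup>2)" for x :: ell2
proof -
  have "Re (cnj z * z) = (cmod z)\<^sup>2" for z
    by (simp add: cmod_power2) (simp add: power2_eq_square)
  then show ?thesis by (simp only: inner_ell2_eq)
qed

lemma summable_Re_coord: "summable (\<lambda>n. Re (cnj (coord x n) * coord y n))"
  by (rule summable_Re[OF coord_mult_summable])

instance
proof
  fix x y z :: ell2 and r :: real
  show "dist x y = norm (x - y)" by (rule dist_ell2_def)
  show "sgn x = x /\<^sub>R norm x" by (rule sgn_ell2_def)
  show "uniformity = (INF e\<in>{0<..}. principal {(x::ell2, y). dist x y < e})"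
    by (rule uniformity_ell2_def)
  show "open U = (\<forall>x\<in>U. eventually (\<lambda>(x', y). x' = x \<longrightarrow> y \<in> U) uniformity)" for U :: "ell2 set"
    by (rule open_ell2_def)
  show "inner x y = inner y x"
    by (simp add: inner_ell2_eq mult.commute)
  show "inner (x + y) z = inner x z + inner y z"
    unfolding inner_ell2_eq
    by (subst suminf_add[OF summable_Re_coord summable_Re_coord]) (simp add: algebra_simps)
  show "inner (r *\<^sub>R x) y = r * inner x y"
    unfolding inner_ell2_eq
    by (subst suminf_mult[OF summable_Re_coord, symmetric]) (simp add: algebra_simps)
  show "0 \<le> inner x x"
    unfolding inner_ell2_self by (rule suminf_nonneg[OF coord_summable]) simp
  show "(inner x x = 0) = (x = 0)"
  proof -
    have "inner x x = 0 \<longleftrightarrow> (\<forall>n. coord x n = 0)"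
      unfolding inner_ell2_self
      by (subst suminf_eq_zero_iff[OF coord_summable]) simp_all
    also have "\<dots> \<longleftrightarrow> x = 0"
      by (metis coord_zero ell2_eqI)
    finally show ?thesis .
  qed
  show "norm x = sqrt (inner x x)" by (rule norm_ell2_def)
qed

end

lemma norm_ell2_square: "(norm x)\<^sup>2 = (\<Sum>n. (cmod (coord x n))\<^sup>2)" for x :: ell2
  by (simp only: power2_norm_eq_inner inner_ell2_self)

lemma ell2_partial_le: "(\<Sum>n<M. (cmod (coord x n))\<^sup>2) \<le> (norm x)\<^sup>2"
  unfolding norm_ell2_square by (rule sum_le_suminf[OF coord_summable]) auto

lemma coord_le_norm: "cmod (coord x n) \<le> norm x"
proof -
  have "(cmod (coord x n))\<^sup>2 \<le> (\<Sum>k<Suc n. (cmod (coord x k))\<^sup>2)"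
    by (rule member_le_sum) auto
  then have "(cmod (coord x n))\<^sup>2 \<le> (norm x)\<^sup>2"
    using ell2_partial_le[where x = x and M = "Suc n"] by linarith
  then show ?thesis
    by (rule power2_le_imp_le) simp
qed

instance ell2 :: complete_space
proof
  fix X :: "nat \<Rightarrow> ell2"
  assume "Cauchy X"
  have "Cauchy (\<lambda>k. coord (X k) n)" for n
  proof (rule CauchyI)
    fix e :: real assume "0 < e"
    then obtain N where "\<forall>m\<ge>N. \<forall>k\<ge>N. norm (X m - X k) < e"
      using CauchyD[OF \<open>Cauchy X\<close>] by blast
    then show "\<exists>N. \<forall>m\<ge>N. \<forall>k\<ge>N. norm (coord (X m) n - coord (X k) n) < e"
      by (metis coord_le_norm coord_minus order_le_less_trans)
  qed
  then have "\<exists>l. (\<lambda>k. coord (X k) n) \<longlonglongrightarrow> l" for n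
    using Cauchy_convergent convergent_def by blast
  then obtain l where l: "\<And>n. (\<lambda>k. coord (X k) n) \<longlonglongrightarrow> l n"
    by metis
  have bound: "(\<Sum>n<M. (cmod (coord (X m) n - l n))\<^sup>2) \<le> e\<^sup>2"
    if N: "\<forall>m\<ge>N. \<forall>k\<ge>N. norm (X m - X k) < e" and "m \<ge> N" for N M m e
  proof (rule Lim_bounded)
    show "(\<lambda>k. \<Sum>n<M. (cmod (coord (X m) n - coord (X k) n))\<^sup>2)
        \<longlonglongrightarrow> (\<Sum>n<M. (cmod (coord (X m) n - l n))\<^sup>2)"
      by (intro tendsto_intros l)
    show "\<forall>k\<ge>N. (\<Sum>n<M. (cmod (coord (X m) n - coord (X k) n))\<^sup>2) \<le> e\<^sup>2"
    proof (intro allI impI)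
      fix k assume "N \<le> k"
      then have "norm (X m - X k) \<le> e" using N \<open>m \<ge> N\<close> by (simp add: less_imp_le)
      then have "(norm (X m - X k))\<^sup>2 \<le> e\<^sup>2" by (rule power_mono) simp
      then show "(\<Sum>n<M. (cmod (coord (X m) n - coord (X k) n))\<^sup>2) \<le> e\<^sup>2"
        using ell2_partial_le[where x = "X m - X k" and M = M] by simp
    qed
  qed
  have sum_diff: "summable (\<lambda>n. (cmod (coord (X m) n - l n))\<^sup>2)"
    if "\<forall>m\<ge>N. \<forall>k\<ge>N. norm (X m - X k) < e" "m \<ge> N" for N m e
  proof (rule bounded_imp_summable)
    show "0 \<le> (cmod (coord (X m) n - l n))\<^sup>2" for n by simp
    show "(\<Sum>k\<le>M. (cmod (coord (X m) k - l k))\<^sup>2) \<le> e\<^sup>2" for M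
      using bound[OF that, of "Suc M"] by (simp only: lessThan_Suc_atMost)
  qed
  have "summable (\<lambda>n. (cmod (l n))\<^sup>2)"
  proof -
    obtain N where N: "\<forall>m\<ge>N. \<forall>k\<ge>N. norm (X m - X k) < 1"
      using CauchyD[OF \<open>Cauchy X\<close>, of 1] by auto
    have "summable (\<lambda>n. (cmod ((- 1) * (coord (X N) n - l n)))\<^sup>2)"
      using sum_diff[OF N order_refl] by (rule ell2_scale)
    from ell2_add[OF coord_summable[of "X N"] this] show ?thesis by simp
  qed
  then have coord_lim: "coord (Abs_ell2 l) = l"
    by (simp add: Abs_ell2_inverse)
  have "X \<longlonglongrightarrow> Abs_ell2 l"
  proof (rule LIMSEQ_I)
    fix r :: real assume "0 < r"
    then obtain N where N: "\<forall>m\<ge>N. \<forall>k\<ge>N. norm (X m - X k) < r / 2"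
      using CauchyD[OF \<open>Cauchy X\<close>, of "r / 2"] by auto
    have "norm (X m - Abs_ell2 l) < r" if "m \<ge> N" for m
    proof -
      have "(norm (X m - Abs_ell2 l))\<^sup>2 \<le> (r / 2)\<^sup>2"
        unfolding norm_ell2_square coord_minus coord_lim
        by (rule suminf_le_const[OF sum_diff[OF N that] bound[OF N that]])
      then have "norm (X m - Abs_ell2 l) \<le> r / 2"
        by (rule power2_le_imp_le) (use \<open>0 < r\<close> in simp)
      then show ?thesis using \<open>0 < r\<close> by simp
    qed
    then show "\<exists>N. \<forall>m\<ge>N. norm (X m - Abs_ell2 l) < r" by blast
  qed
  then show "convergent X" by (auto simp: convergent_def)
qed

instantiation ell2 :: chilbert_space
begin

definition cinner_ell2 :: "ell2 \<Rightarrow> ell2 \<Rightarrow> complex" where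
  "cinner_ell2 x y = (\<Sum>n. cnj (coord x n) * coord y n)"

instance
proof
  fix x y z :: ell2 and c :: complex
  show "cinner x y = cnj (cinner y x)"
    unfolding cinner_ell2_def
    using sums_cnj[THEN iffD2, OF summable_sums[OF coord_mult_summable[of y x]]]
    by (simp add: sums_iff mult.commute)
  show "cinner x (y + z) = cinner x y + cinner x z"
    unfolding cinner_ell2_def
    by (subst suminf_add[OF coord_mult_summable coord_mult_summable]) (simp add: algebra_simps)
  show "cinner x (c *\<^sub>C y) = c * cinner x y"
    unfolding cinner_ell2_def
    by (subst suminf_mult[OF coord_mult_summable, symmetric]) (simp add: algebra_simps)
  show "Re (cinner x y) = inner x y"
    by (simp add: cinner_ell2_def inner_ell2_def)
qed

end


section \<open>The C*-algebra of quantum SU(2)\<close>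

definition suq2_relations :: "real \<Rightarrow> 'a::cstar_algebra \<Rightarrow> 'a \<Rightarrow> bool" where
  "suq2_relations q \<alpha> \<beta> \<longleftrightarrow>
     star \<alpha> * \<alpha> + star \<beta> * \<beta> = 1 \<and>
     \<alpha> * star \<alpha> + q\<^sup>2 *\<^sub>R (\<beta> * star \<beta>) = 1 \<and>
     \<alpha> * \<beta> = q *\<^sub>R (\<beta> * \<alpha>) \<and>
     \<alpha> * star \<beta> = q *\<^sub>R (star \<beta> * \<alpha>) \<and>
     star \<beta> * \<beta> = \<beta> * star \<beta>"

text \<open>The same relations for operators; \<open>A'\<close> and \<open>B'\<close> are the adjoints of \<open>A\<close> and \<open>B\<close>.\<close>

definition suq2_operator_relations ::
    "real \<Rightarrow> ('h::chilbert_space \<Rightarrow> 'h) \<Rightarrow> ('h \<Rightarrow> 'h) \<Rightarrow> ('h \<Rightarrow> 'h) \<Rightarrow> ('h \<Rightarrow> 'h) \<Rightarrow> bool" where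
  "suq2_operator_relations q A A' B B' \<longleftrightarrow>
     bounded_clinear A \<and> bounded_clinear A' \<and> is_adjoint A A' \<and>
     bounded_clinear B \<and> bounded_clinear B' \<and> is_adjoint B B' \<and>
     (\<forall>x. A' (A x) + B' (B x) = x) \<and>
     (\<forall>x. A (A' x) + q\<^sup>2 *\<^sub>R B (B' x) = x) \<and>
     (\<forall>x. A (B x) = q *\<^sub>R B (A x)) \<and>
     (\<forall>x. A (B' x) = q *\<^sub>R B' (A x)) \<and>
     (\<forall>x. B' (B x) = B (B' x))"

text \<open>Universality is tested against operators on \<open>ell2\<close>. This covers all unital C*-algebras:
  two elements generate a separable C*-algebra, which embeds unitally into the bounded operators
  on \<open>ell2\<close>. Uniqueness of the representation is automatic, as \<open>\<alpha>\<close> and \<open>\<beta>\<close> generate.\<close>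

definition universal_suq2 :: "real \<Rightarrow> 'a::cstar_algebra \<Rightarrow> 'a \<Rightarrow> bool" where
  "universal_suq2 q \<alpha> \<beta> \<longleftrightarrow>
     suq2_relations q \<alpha> \<beta> \<and>
     (\<forall>S. star_subalgebra S \<and> closed S \<and> \<alpha> \<in> S \<and> \<beta> \<in> S \<longrightarrow> S = UNIV) \<and>
     (\<forall>(A :: ell2 \<Rightarrow> ell2) A' B B'. suq2_operator_relations q A A' B B' \<longrightarrow>
        (\<exists>\<phi>. star_representation \<phi> \<and> \<phi> \<alpha> = A \<and> \<phi> \<beta> = B))"


section \<open>The Haar state\<close>

datatype gen = Alpha | AlphaS | Beta | BetaS

fun gen_val :: "'a::cstar_algebra \<Rightarrow> 'a \<Rightarrow> gen \<Rightarrow> 'a" where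
  "gen_val \<alpha> \<beta> Alpha = \<alpha>"
| "gen_val \<alpha> \<beta> AlphaS = star \<alpha>"
| "gen_val \<alpha> \<beta> Beta = \<beta>"
| "gen_val \<alpha> \<beta> BetaS = star \<beta>"

definition word_val :: "'a::cstar_algebra \<Rightarrow> 'a \<Rightarrow> gen list \<Rightarrow> 'a" where
  "word_val \<alpha> \<beta> w = prod_list (map (gen_val \<alpha> \<beta>) w)"

text \<open>The comultiplication is the *-homomorphism given by
  \<open>\<Delta> \<alpha> = \<alpha> \<otimes> \<alpha> - q \<beta>* \<otimes> \<beta>\<close> and \<open>\<Delta> \<beta> = \<beta> \<otimes> \<alpha> + \<alpha>* \<otimes> \<beta>\<close>.
  It maps the words in the generators into the algebraic tensor product; a list of triples
  \<open>(c, u, v)\<close> encodes the sum of the \<open>c \<cdot> u \<otimes> v\<close>.\<close>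

fun coprod_gen :: "real \<Rightarrow> gen \<Rightarrow> (complex \<times> gen \<times> gen) list" where
  "coprod_gen q Alpha = [(1, Alpha, Alpha), (- of_real q, BetaS, Beta)]"
| "coprod_gen q AlphaS = [(1, AlphaS, AlphaS), (- of_real q, Beta, BetaS)]"
| "coprod_gen q Beta = [(1, Beta, Alpha), (1, AlphaS, Beta)]"
| "coprod_gen q BetaS = [(1, BetaS, AlphaS), (1, Alpha, BetaS)]"

fun coprod_word :: "real \<Rightarrow> gen list \<Rightarrow> (complex \<times> gen list \<times> gen list) list" where
  "coprod_word q [] = [(1, [], [])]"
| "coprod_word q (g # w) =
     [(c * d, x # u, y # v). (c, x, y) \<leftarrow> coprod_gen q g, (d, u, v) \<leftarrow> coprod_word q w]"

text \<open>Invariance \<open>(id \<otimes> h) \<Delta> a = h a \<cdot> 1 = (h \<otimes> id) \<Delta> a\<close> is required for words \<open>a\<close>; it extends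
  to the whole algebra because their linear span is dense and states are continuous.\<close>

definition haar_state :: "real \<Rightarrow> 'a::cstar_algebra \<Rightarrow> 'a \<Rightarrow> ('a \<Rightarrow> complex) \<Rightarrow> bool" where
  "haar_state q \<alpha> \<beta> h \<longleftrightarrow> state h \<and>
     (\<forall>w. (\<Sum>(c, u, v)\<leftarrow>coprod_word q w. (c * h (word_val \<alpha> \<beta> v)) *\<^sub>C word_val \<alpha> \<beta> u)
            = h (word_val \<alpha> \<beta> w) *\<^sub>C 1 \<and>
          (\<Sum>(c, u, v)\<leftarrow>coprod_word q w. (c * h (word_val \<alpha> \<beta> u)) *\<^sub>C word_val \<alpha> \<beta> v)
            = h (word_val \<alpha> \<beta> w) *\<^sub>C 1)"


section \<open>The canonical basis\<close>

definition spins :: "real \<Rightarrow> real set" where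
  "spins n = {- n + real k | k. real k \<le> 2 * n}"

definition idx :: "(real \<times> real \<times> real) set" where
  "idx = {(n, i, j). 2 * n \<in> \<nat> \<and> i \<in> spins n \<and> j \<in> spins n}"

definition a_plus :: "real \<Rightarrow> real \<Rightarrow> real \<Rightarrow> real \<Rightarrow> real" where
  "a_plus q n i j = sqrt (q powr (2 * (n + i) + 2 * (n + j) + 2) *
     ((1 - q powr (2 * n - 2 * j + 2)) * (1 - q powr (2 * n - 2 * i + 2)) /
      ((1 - q powr (4 * n + 2)) * (1 - q powr (4 * n + 4)))))"

definition a_minus :: "real \<Rightarrow> real \<Rightarrow> real \<Rightarrow> real \<Rightarrow> real" where
  "a_minus q n i j = sqrt ((1 - q powr (2 * n + 2 * j)) * (1 - q powr (2 * n + 2 * i)) /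
      ((1 - q powr (4 * n)) * (1 - q powr (4 * n + 2))))"

definition b_plus :: "real \<Rightarrow> real \<Rightarrow> real \<Rightarrow> real \<Rightarrow> real" where
  "b_plus q n i j = - sqrt (q powr (2 * (n + j)) *
     ((1 - q powr (2 * n - 2 * j + 2)) * (1 - q powr (2 * n + 2 * i + 2)) /
      ((1 - q powr (4 * n + 2)) * (1 - q powr (4 * n + 4)))))"

definition b_minus :: "real \<Rightarrow> real \<Rightarrow> real \<Rightarrow> real \<Rightarrow> real" where
  "b_minus q n i j = sqrt (q powr (2 * (n + i)) *
     ((1 - q powr (2 * n + 2 * j)) * (1 - q powr (2 * n - 2 * i)) /
      ((1 - q powr (4 * n)) * (1 - q powr (4 * n + 2)))))"

definition basis_or_zero ::
    "(real \<Rightarrow> real \<Rightarrow> real \<Rightarrow> 'h::chilbert_space) \<Rightarrow> real \<Rightarrow> real \<Rightarrow> real \<Rightarrow> 'h" where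
  "basis_or_zero e n i j = (if (n, i, j) \<in> idx then e n i j else 0)"

definition orthonormal_basis ::
    "(real \<Rightarrow> real \<Rightarrow> real \<Rightarrow> 'h::chilbert_space) \<Rightarrow> bool" where
  "orthonormal_basis e \<longleftrightarrow>
     (\<forall>(n, i, j)\<in>idx. \<forall>(m, k, l)\<in>idx.
        cinner (e n i j) (e m k l) = (if (n, i, j) = (m, k, l) then 1 else 0)) \<and>
     (\<forall>x. (\<forall>(n, i, j)\<in>idx. cinner (e n i j) x = 0) \<longrightarrow> x = 0)"

text \<open>The conditions below determine the canonical basis: a unitary mapping one such basis to
  another commutes with \<open>\<pi>\<close> and fixes the cyclic vector \<open>\<Lambda> 1\<close>, so it is the identity.\<close>

definition canonical_basis ::
    "real \<Rightarrow> 'a::cstar_algebra \<Rightarrow> 'a \<Rightarrow> ('a \<Rightarrow> 'h::chilbert_space \<Rightarrow> 'h) \<Rightarrow> ('a \<Rightarrow> 'h) \<Rightarrow>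
     (real \<Rightarrow> real \<Rightarrow> real \<Rightarrow> 'h) \<Rightarrow> bool" where
  "canonical_basis q \<alpha> \<beta> \<pi> \<Lambda> e \<longleftrightarrow>
     orthonormal_basis e \<and> e 0 0 0 = \<Lambda> 1 \<and>
     (\<forall>(n, i, j)\<in>idx.
        \<pi> \<alpha> (e n i j) =
          a_plus q n i j *\<^sub>R basis_or_zero e (n + 1/2) (i - 1/2) (j - 1/2) +
          a_minus q n i j *\<^sub>R basis_or_zero e (n - 1/2) (i - 1/2) (j - 1/2) \<and>
        \<pi> \<beta> (e n i j) =
          b_plus q n i j *\<^sub>R basis_or_zero e (n + 1/2) (i + 1/2) (j - 1/2) +
          b_minus q n i j *\<^sub>R basis_or_zero e (n - 1/2) (i + 1/2) (j - 1/2))"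


section \<open>The equivariant Dirac operator\<close>

definition dirac_eigenvalue :: "real \<Rightarrow> real \<Rightarrow> real" where
  "dirac_eigenvalue n i = (if i = n then - (2 * n + 1) else 2 * n + 1)"

text \<open>The self-adjoint operator that is diagonal in the basis \<open>e\<close>, on its maximal domain.\<close>

definition dirac_domain :: "(real \<Rightarrow> real \<Rightarrow> real \<Rightarrow> 'h::chilbert_space) \<Rightarrow> 'h set" where
  "dirac_domain e =
     {x. (\<lambda>(n, i, j). (dirac_eigenvalue n i * cmod (cinner (e n i j) x))\<^sup>2) summable_on idx}"

definition dirac :: "(real \<Rightarrow> real \<Rightarrow> real \<Rightarrow> 'h::chilbert_space) \<Rightarrow> 'h \<Rightarrow> 'h" where
  "dirac e x =
     (\<Sum>\<^sub>\<infinity>(n, i, j)\<in>idx. (of_real (dirac_eigenvalue n i) * cinner (e n i j) x) *\<^sub>C e n i j)"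

text \<open>For an unbounded \<open>D\<close>, boundedness of \<open>[D, T]\<close> includes that \<open>T\<close> preserves the domain \<open>V\<close>
  of \<open>D\<close>, so that the commutator is defined there.\<close>

definition bounded_commutator ::
    "'h::chilbert_space set \<Rightarrow> ('h \<Rightarrow> 'h) \<Rightarrow> ('h \<Rightarrow> 'h) \<Rightarrow> bool" where
  "bounded_commutator V D T \<longleftrightarrow>
     T ` V \<subseteq> V \<and> (\<exists>C. \<forall>x\<in>V. norm (D (T x) - T (D x)) \<le> C * norm x)"

end

theory Submission
  imports Defs
begin

text \<open>
  Write \<open>\<Omega> = e 0 0 0\<close> for the cyclic vector and \<open>P\<close> for the projection onto the ``top row'',
  the closed span of the basis vectors with \<open>i = n\<close>, on which the Dirac operator \<open>D\<close> is negative;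
  on the complement it is positive. Since \<open>T\<close> is determined by the functional \<open>x \<mapsto> \<langle>\<Omega>, T x\<rangle>\<close>, it
  suffices to show that this functional is a multiple of \<open>\<langle>\<Omega>, x\<rangle>\<close>, that is, that \<open>\<eta> = T* \<Omega>\<close> is a
  multiple of \<open>\<Omega>\<close>. The crux is that both \<open>\<xi> = T \<Omega>\<close> and \<open>\<eta>\<close> lie in the top row.

  Up to nonzero scalars the basis vectors in the top row are \<open>\<alpha>*\<^sup>a \<beta>\<^sup>b \<Omega>\<close>. As \<open>D\<close> has eigenvalue \<open>-(a + 1)\<close>
  on the multiple \<open>v\<close> of \<open>\<alpha>*\<^sup>a \<Omega>\<close> and is positive on the range of \<open>1 - P\<close>, the bound on \<open>[D, T]\<close>
  yields \<open>(a + 1) \<parallel>(1 - P) T v\<parallel> \<le> C\<close>, and likewise for \<open>T*\<close>. Because \<open>T\<close> and \<open>T*\<close> commute with \<open>\<alpha>*\<close>,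
  the translates \<open>\<alpha>*\<^sup>a \<xi>\<close> and \<open>\<alpha>*\<^sup>a \<eta>\<close> approach the top row at the rate \<open>1 / (a + 1)\<close>
  (\<open>commutator_decay\<close>, \<open>adjoint_commutator_decay\<close>).

  Such a decay forces a vector into the top row (\<open>top_if_translates_decay\<close>). It may be assumed to
  have a fixed weight \<open>(i + j, i - j)\<close>; then at most one basis vector of the top row is relevant for
  each \<open>a\<close>, none if \<open>i < j\<close> and otherwise a multiple of \<open>\<alpha>*\<^bsup>a+s\<^esup> \<beta>\<^sup>b \<Omega>\<close> with \<open>s = i + j\<close> and \<open>b = i - j\<close>. Powers of \<open>\<alpha>*\<close> are
  bounded below uniformly in the exponent (\<open>norm_A'_pow_ge\<close>), so \<open>\<alpha>*\<^sup>a\<close> can be cancelled. For \<open>s \<ge> 0\<close> this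
  exhibits the vector as a limit of multiples of \<open>\<alpha>*\<^sup>s \<beta>\<^sup>b \<Omega>\<close>. For \<open>s = -m < 0\<close> it would exhibit
  \<open>\<alpha>*\<^sup>m\<close> of the vector as a limit of multiples of \<open>\<beta>\<^sup>b \<Omega>\<close>; the limit must be \<open>0\<close>, since
  \<open>\<parallel>\<beta>\<^sup>N \<alpha>* y\<parallel> \<le> q\<^sup>N \<parallel>y\<parallel>\<close>, whereas \<open>\<parallel>\<beta>\<^sup>N \<Omega>\<parallel>\<close> stays away from \<open>0\<close>.

  Finally \<open>\<langle>\<eta>, \<alpha>*\<^sup>a \<beta>\<^sup>b \<Omega>\<rangle> = \<langle>\<Omega>, \<alpha>*\<^sup>a \<beta>\<^sup>b \<xi>\<rangle>\<close>, and this vanishes unless \<open>a = b = 0\<close>, because \<open>\<alpha>*\<close> and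
  \<open>\<beta>\<close> map the top row into its part orthogonal to \<open>\<Omega>\<close>. Hence \<open>\<eta>\<close>, a vector of the top row, is a
  multiple of \<open>\<Omega>\<close>.\<close>

section \<open>Elementary estimates and iterates\<close>

lemma prod_one_minus_powers_ge:
  fixes p :: real
  assumes "0 < p" "p < 1"
  obtains \<rho> where "0 < \<rho>" "\<And>a. \<rho> \<le> (\<Prod>l<a. 1 - p * p ^ l)"
proof -
  let ?f = "\<lambda>l. 1 - p * p ^ l"
  have f: "0 < ?f l" "?f l \<le> 1" for l
    using power_Suc_less_one[of p l] assms by auto
  have "summable (\<lambda>l. norm (?f l - 1))"
    using assms by (simp add: abs_mult summable_mult summable_geometric)
  then have "abs_convergent_prod ?f"
    by (rule summable_imp_abs_convergent_prod)
  then have conv: "convergent_prod ?f"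
    by (rule abs_convergent_prod_imp_convergent_prod)
  have lim: "(\<lambda>n. \<Prod>l\<le>n. ?f l) \<longlonglongrightarrow> prodinf ?f"
    by (rule convergent_prod_LIMSEQ[OF conv])
  have dec: "decseq (\<lambda>n. \<Prod>l\<le>n. ?f l)"
    unfolding decseq_Suc_iff prod.atMost_Suc
    by (intro allI mult_left_le prod_nonneg ballI f(2) less_imp_le[OF f(1)])
  have "prodinf ?f \<noteq> 0"
    using f by (intro prodinf_nonzero[OF conv]) (metis less_irrefl)
  moreover have "0 \<le> prodinf ?f"
    by (rule LIMSEQ_le_const[OF lim]) (intro exI allI impI prod_nonneg ballI less_imp_le[OF f(1)])
  moreover have "prodinf ?f \<le> (\<Prod>l<a. ?f l)" for a
  proof (cases a)
    case 0
    have "prodinf ?f \<le> (\<Prod>l\<le>0. ?f l)" by (rule decseq_ge[OF dec lim])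
    also have "\<dots> \<le> 1" using assms by simp
    finally show ?thesis using 0 by simp
  next
    case (Suc b)
    then show ?thesis using decseq_ge[OF dec lim, of b] by (simp add: lessThan_Suc_atMost)
  qed
  ultimately show thesis using that[of "prodinf ?f"] by simp
qed

lemma nonpos_if_le_harmonic:
  fixes t K :: real
  assumes "\<And>a::nat. t \<le> K / (real a + 1)"
  shows "t \<le> 0"
proof (rule ccontr)
  assume "\<not> t \<le> 0"
  then have "0 < t" by simp
  obtain a :: nat where "K / t < real a" using reals_Archimedean2 by blast
  then have "K < t * (real a + 1)" using \<open>0 < t\<close> by (simp add: field_simps)
  then have "K / (real a + 1) < t" by (simp add: field_simps)
  with assms[of a] show False by simp
qed

lemma le_if_le_geometric:
  fixes s t M p :: real
  assumes "\<And>N::nat. s \<le> t + p ^ N * M" "0 \<le> p" "p < 1"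
  shows "s \<le> t"
proof (rule LIMSEQ_le_const)
  have "(\<lambda>N. t + p ^ N * M) \<longlonglongrightarrow> t + 0 * M"
    using assms(2,3) by (intro tendsto_intros LIMSEQ_realpow_zero)
  then show "(\<lambda>N. t + p ^ N * M) \<longlonglongrightarrow> t" by simp
  show "\<exists>N. \<forall>n\<ge>N. s \<le> t + p ^ n * M" using assms(1) by blast
qed

lemma funpow_commute: "(\<And>x. T (f x) = f (T x)) \<Longrightarrow> T ((f ^^ a) x) = (f ^^ a) (T x)"
  by (induction a arbitrary: x) auto

lemma norm_funpow_le:
  fixes f :: "'a::real_normed_vector \<Rightarrow> 'a"
  assumes "\<And>x. norm (f x) \<le> norm x"
  shows "norm ((f ^^ a) x) \<le> norm x"
proof (induction a)
  case (Suc a)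
  have "norm ((f ^^ Suc a) x) \<le> norm ((f ^^ a) x)" using assms by simp
  with Suc show ?case by linarith
qed simp

lemma clinearD:
  assumes "clinear f"
  shows "f (x + y) = f x + f y" "f (c *\<^sub>C x) = c *\<^sub>C f x" "f (r *\<^sub>R x) = r *\<^sub>R f x"
    "f (x - y) = f x - f y"
proof -
  show add: "f (x + y) = f x + f y" for x y
    using assms by (simp add: clinear_def)
  show "f (c *\<^sub>C x) = c *\<^sub>C f x"
    using assms by (simp add: clinear_def)
  show "f (r *\<^sub>R x) = r *\<^sub>R f x"
    using assms by (simp add: clinear_def scaleC_of_real[symmetric])
  show "f (x - y) = f x - f y"
    using add[of "x - y" y] by simp
qed

lemma clinear_funpow: "clinear f \<Longrightarrow> clinear (f ^^ a)" for f :: "'a::complex_vector \<Rightarrow> 'a"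
  by (induction a) (auto simp: clinear_def)


section \<open>Orthonormal bases of complex Hilbert spaces\<close>

lemma cinner_add_left: "cinner (x + y) z = cinner x z + cinner y (z :: 'h::chilbert_space)"
  by (metis cinner_add_right cinner_commute complex_cnj_add)

lemma cinner_scaleC_left: "cinner (c *\<^sub>C x) z = cnj c * cinner x (z :: 'h::chilbert_space)"
  by (metis cinner_commute cinner_scaleC_right complex_cnj_mult)

lemma cinner_scaleR_right: "cinner x (r *\<^sub>R y) = of_real r * cinner x (y :: 'h::chilbert_space)"
  by (simp add: scaleC_of_real[symmetric] cinner_scaleC_right)

lemma cinner_scaleR_left: "cinner (r *\<^sub>R x) y = of_real r * cinner x (y :: 'h::chilbert_space)"
  by (simp add: scaleC_of_real[symmetric] cinner_scaleC_left)

lemma cinner_zero_right [simp]: "cinner x (0 :: 'h::chilbert_space) = 0"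
  using cinner_scaleR_right[of x 0 0] by simp

lemma cinner_zero_left [simp]: "cinner (0 :: 'h::chilbert_space) x = 0"
  using cinner_scaleR_left[of 0 0 x] by simp

lemma cinner_diff_right: "cinner x (y - z) = cinner x y - cinner x (z :: 'h::chilbert_space)"
  using cinner_add_right[of x "y - z" z] by simp

lemma cinner_sum_right:
  "cinner x (\<Sum>k\<in>F. f k) = (\<Sum>k\<in>F. cinner x (f k :: 'h::chilbert_space))"
  by (induction F rule: infinite_finite_induct) (auto simp: cinner_add_right)

lemma cinner_sum_left:
  "cinner (\<Sum>k\<in>F. f k) x = (\<Sum>k\<in>F. cinner (f k) (x :: 'h::chilbert_space))"
  by (induction F rule: infinite_finite_induct) (auto simp: cinner_add_left)

lemma cinner_self: "cinner x (x :: 'h::chilbert_space) = of_real ((norm x)\<^sup>2)"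
proof -
  have "Im (cinner x x) = 0"
    using arg_cong[OF cinner_commute[of x x], of Im] by simp
  then show ?thesis
    by (simp add: complex_eq_iff Re_cinner power2_norm_eq_inner)
qed

lemma scaleC_zero_left [simp]: "0 *\<^sub>C x = (0 :: 'h::chilbert_space)"
  using scaleC_of_real[of 0 x] by simp

lemma norm_scaleC_hilbert: "norm (c *\<^sub>C x) = cmod c * norm (x :: 'h::chilbert_space)"
proof -
  have "complex_of_real ((norm (c *\<^sub>C x))\<^sup>2) = (c * cnj c) * cinner x x"
    by (simp only: cinner_self[symmetric] cinner_scaleC_left cinner_scaleC_right mult_ac)
  also have "\<dots> = of_real ((cmod c * norm x)\<^sup>2)"
    by (simp only: cinner_self complex_norm_square[symmetric] power_mult_distrib of_real_mult)
  finally have "(norm (c *\<^sub>C x))\<^sup>2 = (cmod c * norm x)\<^sup>2"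
    by (simp only: of_real_eq_iff)
  then show ?thesis by (simp add: power2_eq_iff_nonneg)
qed

lemma cinner_Cauchy_Schwarz: "cmod (cinner x y) \<le> norm x * norm (y :: 'h::chilbert_space)"
proof (cases "cinner x y = 0")
  case False
  define c where "c = cnj (cinner x y) / cmod (cinner x y)"
  have c: "cmod c = 1" using False by (simp add: c_def norm_divide)
  have "cinner x (c *\<^sub>C y) = (cinner x y * cnj (cinner x y)) / cmod (cinner x y)"
    by (simp add: cinner_scaleC_right c_def)
  also have "\<dots> = of_real (cmod (cinner x y))"
    using False by (simp only: complex_norm_square[symmetric]) (simp add: power2_eq_square)
  finally have cxy: "cinner x (c *\<^sub>C y) = of_real (cmod (cinner x y))" .
  from cxy have "cmod (cinner x y) = inner x (c *\<^sub>C y)"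
    by (metis Re_cinner Re_complex_of_real)
  also have "\<dots> \<le> norm x * norm (c *\<^sub>C y)" by (rule norm_cauchy_schwarz)
  finally show ?thesis by (simp add: norm_scaleC_hilbert c)
qed simp

lemma bounded_linear_cinner_right: "bounded_linear (cinner (x :: 'h::chilbert_space))"
  by (rule bounded_linear_intro[of _ "norm x"])
     (use cinner_Cauchy_Schwarz[of x] in
       \<open>auto simp: cinner_add_right cinner_scaleR_right scaleR_conv_of_real mult.commute\<close>)

lemma cinner_eqI: "(\<And>z. cinner z x = cinner z (y :: 'h::chilbert_space)) \<Longrightarrow> x = y"
proof -
  assume "\<And>z. cinner z x = cinner z y"
  then have "cinner (x - y) (x - y) = 0" by (simp add: cinner_diff_right)
  then show ?thesis by (simp add: cinner_self)
qed

lemma Re_cinner_self: "Re (cinner x x) = (norm (x :: 'h::chilbert_space))\<^sup>2"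
  by (simp only: cinner_self Re_complex_of_real)

lemma norm_square_adjoint:
  fixes f g :: "'h::chilbert_space \<Rightarrow> 'h"
  assumes "\<And>x y. cinner (f x) y = cinner x (g y)"
  shows "(norm (f x))\<^sup>2 = Re (cinner x (g (f x)))"
  by (metis assms Re_cinner_self)

text \<open>A complete orthonormal system \<open>u\<close> indexed by a set of arbitrary cardinality.\<close>

locale hilbert_basis =
  fixes I :: "'i set" and u :: "'i \<Rightarrow> 'h::chilbert_space"
  assumes ortho: "k \<in> I \<Longrightarrow> l \<in> I \<Longrightarrow> cinner (u k) (u l) = (if k = l then 1 else 0)"
    and total: "(\<And>k. k \<in> I \<Longrightarrow> cinner (u k) x = 0) \<Longrightarrow> x = 0"
begin

lemma basis_eqI: "(\<And>k. k \<in> I \<Longrightarrow> cinner (u k) x = cinner (u k) y) \<Longrightarrow> x = y"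
  using total[of "x - y"] by (simp add: cinner_diff_right)

lemma norm_basis: "k \<in> I \<Longrightarrow> norm (u k) = 1"
proof -
  assume "k \<in> I"
  then have "complex_of_real ((norm (u k))\<^sup>2) = 1"
    using ortho[of k k] cinner_self[of "u k"] by simp
  then have "(norm (u k))\<^sup>2 = 1"
    by (simp only: of_real_eq_1_iff)
  then show ?thesis by (simp add: power2_eq_1_iff) (use norm_ge_zero[of "u k"] in linarith)
qed

lemma cinner_basis_sum:
  assumes "finite F" "F \<subseteq> I" "k \<in> I"
  shows "cinner (u k) (\<Sum>l\<in>F. c l *\<^sub>C u l) = (if k \<in> F then c k else 0)"
proof -
  have "cinner (u k) (\<Sum>l\<in>F. c l *\<^sub>C u l) = (\<Sum>l\<in>F. if l = k then c l else 0)"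
    unfolding cinner_sum_right
    by (rule sum.cong) (use assms in \<open>auto simp: cinner_scaleC_right ortho\<close>)
  also have "\<dots> = (if k \<in> F then c k else 0)"
    using assms by (simp add: sum.delta)
  finally show ?thesis .
qed

lemma norm_basis_sum:
  assumes "finite F" "F \<subseteq> I"
  shows "(norm (\<Sum>k\<in>F. c k *\<^sub>C u k))\<^sup>2 = (\<Sum>k\<in>F. (cmod (c k))\<^sup>2)"
proof -
  have "complex_of_real ((norm (\<Sum>k\<in>F. c k *\<^sub>C u k))\<^sup>2) = (\<Sum>k\<in>F. cnj (c k) * c k)"
    unfolding cinner_self[symmetric] cinner_sum_left
    by (rule sum.cong[OF refl], subst cinner_scaleC_left, subst cinner_basis_sum)
       (use assms in auto)
  also have "\<dots> = of_real (\<Sum>k\<in>F. (cmod (c k))\<^sup>2)"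
    by (simp add: complex_norm_square mult.commute del: of_real_power)
  finally show ?thesis by (simp only: of_real_eq_iff)
qed

lemma Bessel:
  assumes "finite F" "F \<subseteq> I"
  shows "(\<Sum>k\<in>F. (cmod (cinner (u k) x))\<^sup>2) \<le> (norm x)\<^sup>2"
proof -
  define s where "s = (\<Sum>k\<in>F. cinner (u k) x *\<^sub>C u k)"
  have "cinner s x = (\<Sum>k\<in>F. cnj (cinner (u k) x) * cinner (u k) x)"
    by (simp add: s_def cinner_sum_left cinner_scaleC_left)
  also have "\<dots> = of_real ((norm s)\<^sup>2)"
    unfolding s_def norm_basis_sum[OF assms] by (simp add: complex_norm_square mult.commute del: of_real_power)
  finally have "inner s x = (norm s)\<^sup>2"
    by (metis Re_cinner Re_complex_of_real)
  then have "(norm s)\<^sup>2 \<le> norm s * norm x"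
    using norm_cauchy_schwarz[of s x] by simp
  then have "norm s \<le> norm x"
    by (cases "norm s = 0") (auto simp: power2_eq_square)
  then show ?thesis
    unfolding s_def[symmetric] norm_basis_sum[OF assms, symmetric]
    by (simp add: power_mono)
qed

lemma coefficients_summable: "(\<lambda>k. (cmod (cinner (u k) x))\<^sup>2) summable_on I"
  by (rule nonneg_bdd_above_summable_on) (auto intro!: bdd_aboveI2[where M = "(norm x)\<^sup>2"] Bessel)

text \<open>Riesz--Fischer: partial sums over finite sets form a Cauchy filter because the squared
  distance of two nested ones is a tail of the sum of squares.\<close>

lemma square_summable_imp_summable:
  assumes "(\<lambda>k. (cmod (c k))\<^sup>2) summable_on I"
  shows "(\<lambda>k. c k *\<^sub>C u k) summable_on I"
proof -
  define f where "f = (\<lambda>k. c k *\<^sub>C u k)"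
  define g where "g = (\<lambda>k. (cmod (c k))\<^sup>2)"
  have "\<exists>P. eventually P (finite_subsets_at_top I) \<and>
              (\<forall>F F'. P F \<and> P F' \<longrightarrow> dist (sum f F) (sum f F') < d)" if "d > 0" for d :: real
  proof -
    obtain F0 where F0: "finite F0" "F0 \<subseteq> I" "dist (sum g F0) (infsum g I) \<le> (d/4)\<^sup>2"
      using infsum_finite_approximation[of g I "(d/4)\<^sup>2"] assms \<open>d > 0\<close> by (auto simp: g_def)
    have near: "dist (sum f F) (sum f F0) < d / 2" if F: "finite F" "F \<subseteq> I" "F0 \<subseteq> F" for F
    proof -
      have "sum f F - sum f F0 = sum f (F - F0)"
        using F by (simp add: sum_diff)
      then have "(dist (sum f F) (sum f F0))\<^sup>2 = sum g (F - F0)"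
        unfolding dist_norm using F
        by (auto simp: f_def g_def intro!: norm_basis_sum)
      also have "\<dots> = sum g F - sum g F0"
        using F by (simp add: sum_diff)
      also have "\<dots> \<le> infsum g I - sum g F0"
        using finite_sum_le_infsum[of g I F] assms F by (simp add: g_def)
      also have "\<dots> \<le> (d/4)\<^sup>2" using F0 by (simp add: dist_real_def)
      finally have "dist (sum f F) (sum f F0) \<le> d / 4"
        by (rule power2_le_imp_le) (use \<open>d > 0\<close> in simp)
      then show ?thesis using \<open>d > 0\<close> by simp
    qed
    show ?thesis
    proof (intro exI conjI allI impI)
      show "eventually (\<lambda>F. finite F \<and> F0 \<subseteq> F \<and> F \<subseteq> I) (finite_subsets_at_top I)"
        unfolding eventually_finite_subsets_at_top using F0 by blast
      fix F F' assume "(finite F \<and> F0 \<subseteq> F \<and> F \<subseteq> I) \<and> (finite F' \<and> F0 \<subseteq> F' \<and> F' \<subseteq> I)"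
      then show "dist (sum f F) (sum f F') < d"
        using near[of F] near[of F'] dist_triangle2[of "sum f F" "sum f F'" "sum f F0"] by auto
    qed
  qed
  then have "cauchy_filter (filtermap (sum f) (finite_subsets_at_top I))"
    by (simp add: cauchy_filter_metric_filtermap)
  moreover have "complete (UNIV :: 'h set)"
    by (meson Cauchy_convergent UNIV_I complete_def convergent_def)
  ultimately obtain L where "(sum f \<longlongrightarrow> L) (finite_subsets_at_top I)"
    using complete_uniform[where S = UNIV] by (force simp add: filterlim_def)
  then show ?thesis
    using summable_on_def has_sum_def unfolding f_def by blast
qed

lemma cinner_basis_infsum:
  assumes "(\<lambda>k. (cmod (c k))\<^sup>2) summable_on I" "l \<in> I"
  shows "cinner (u l) (\<Sum>\<^sub>\<infinity>k\<in>I. c k *\<^sub>C u k) = c l"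
proof -
  have "((\<lambda>k. c k *\<^sub>C u k) has_sum (\<Sum>\<^sub>\<infinity>k\<in>I. c k *\<^sub>C u k)) I"
    by (rule has_sum_infsum[OF square_summable_imp_summable[OF assms(1)]])
  then have "((\<lambda>k. cinner (u l) (c k *\<^sub>C u k)) has_sum
      cinner (u l) (\<Sum>\<^sub>\<infinity>k\<in>I. c k *\<^sub>C u k)) I"
    by (rule has_sum_bounded_linear[OF bounded_linear_cinner_right])
  moreover have "((\<lambda>k. cinner (u l) (c k *\<^sub>C u k)) has_sum c l) I
      \<longleftrightarrow> ((\<lambda>k. if k = l then c k else 0) has_sum c l) I"
    by (rule has_sum_cong) (use assms(2) in \<open>auto simp: cinner_scaleC_right ortho\<close>)
  moreover have "((\<lambda>k. if k = l then c k else 0) has_sum c l) I"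
    by (rule has_sum_finite_neutralI[of "{l}"]) (use assms(2) in auto)
  ultimately show ?thesis
    using has_sum_unique by blast
qed

lemma basis_expansion: "((\<lambda>k. cinner (u k) x *\<^sub>C u k) has_sum x) I"
proof -
  have "(\<Sum>\<^sub>\<infinity>k\<in>I. cinner (u k) x *\<^sub>C u k) = x"
    by (rule basis_eqI) (simp add: cinner_basis_infsum coefficients_summable)
  then show ?thesis
    using has_sum_infsum[OF square_summable_imp_summable[OF coefficients_summable]] by metis
qed

lemma Parseval: "((\<lambda>k. (cmod (cinner (u k) x))\<^sup>2) has_sum (norm x)\<^sup>2) I"
proof -
  have "((\<lambda>k. inner x (cinner (u k) x *\<^sub>C u k)) has_sum inner x x) I"
    by (rule has_sum_bounded_linear[OF bounded_linear_inner_right basis_expansion])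
  moreover have "inner x (cinner (u k) x *\<^sub>C u k) = (cmod (cinner (u k) x))\<^sup>2" for k
  proof -
    have "cinner x (cinner (u k) x *\<^sub>C u k) = of_real ((cmod (cinner (u k) x))\<^sup>2)"
      by (metis cinner_commute cinner_scaleC_right complex_norm_square)
    then show ?thesis by (metis Re_cinner Re_complex_of_real)
  qed
  ultimately show ?thesis by (simp add: power2_norm_eq_inner)
qed

lemma norm_le_if_coefficients_le:
  assumes "\<And>k. k \<in> I \<Longrightarrow> cmod (cinner (u k) x) \<le> cmod (cinner (u k) y)"
  shows "norm x \<le> norm y"
proof -
  have "(norm x)\<^sup>2 \<le> (norm y)\<^sup>2"
    by (rule has_sum_mono[OF Parseval[of x] Parseval[of y]]) (simp add: assms power_mono)
  then show ?thesis by (rule power2_le_imp_le) simp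
qed

text \<open>The orthogonal projection onto the closed span of the basis vectors with index in \<open>S\<close>.\<close>

definition proj :: "'i set \<Rightarrow> 'h \<Rightarrow> 'h" where
  "proj S x = (\<Sum>\<^sub>\<infinity>k\<in>I. (if k \<in> S then cinner (u k) x else 0) *\<^sub>C u k)"

lemma cinner_basis_proj:
  assumes "l \<in> I"
  shows "cinner (u l) (proj S x) = (if l \<in> S then cinner (u l) x else 0)"
  unfolding proj_def
proof (rule cinner_basis_infsum[OF _ assms])
  show "(\<lambda>k. (cmod (if k \<in> S then cinner (u k) x else 0))\<^sup>2) summable_on I"
    by (rule summable_on_comparison_test[OF coefficients_summable[of x]]) auto
qed

lemma norm_proj_le: "norm (proj S x) \<le> norm x"
  by (rule norm_le_if_coefficients_le) (simp add: cinner_basis_proj)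

lemma proj_scaleC: "proj S (c *\<^sub>C x) = c *\<^sub>C proj S x"
  by (rule basis_eqI) (simp add: cinner_basis_proj cinner_scaleC_right)

lemma proj_proj: "proj S (proj S' x) = proj (S \<inter> S') x"
  by (rule basis_eqI) (simp add: cinner_basis_proj)

lemma proj_complement: "x = proj S x + proj (- S) x"
  by (rule basis_eqI) (simp add: cinner_basis_proj cinner_add_right)

lemma cinner_eq_0_if_coefficients:
  assumes "\<And>k. k \<in> I \<Longrightarrow> cinner (u k) x = 0 \<or> cinner (u k) y = 0"
  shows "cinner x y = 0"
proof -
  have "((\<lambda>k. cinner x (cinner (u k) y *\<^sub>C u k)) has_sum cinner x y) I"
    by (rule has_sum_bounded_linear[OF bounded_linear_cinner_right basis_expansion])
  moreover have "cinner x (cinner (u k) y *\<^sub>C u k) = 0" if "k \<in> I" for k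
    using assms[OF that] by (metis cinner_commute cinner_scaleC_right complex_cnj_zero mult_eq_0_iff)
  then have "((\<lambda>k. cinner x (cinner (u k) y *\<^sub>C u k)) has_sum 0) I"
    by (intro has_sum_0) auto
  ultimately show ?thesis using has_sum_unique by blast
qed

lemma proj_singleton:
  assumes "\<And>l. l \<in> I \<Longrightarrow> l \<in> S \<Longrightarrow> l = k" "k \<in> I" "k \<in> S"
  shows "proj S x = cinner (u k) x *\<^sub>C u k"
proof (rule basis_eqI)
  fix l assume l: "l \<in> I"
  show "cinner (u l) (proj S x) = cinner (u l) (cinner (u k) x *\<^sub>C u k)"
  proof (cases "l = k")
    case True
    then show ?thesis
      using assms(2,3) by (simp add: cinner_basis_proj cinner_scaleC_right ortho)
  next
    case False
    moreover from this have "l \<notin> S" using assms(1) l by blast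
    ultimately show ?thesis
      using assms(2) l by (simp add: cinner_basis_proj cinner_scaleC_right ortho)
  qed
qed

lemma Riesz_representation:
  fixes \<phi> :: "'h \<Rightarrow> complex"
  assumes "bounded_linear \<phi>" "\<And>c x. \<phi> (c *\<^sub>C x) = c * \<phi> x"
  obtains y where "\<And>x. \<phi> x = cinner y x"
proof -
  obtain K where K: "\<And>x. cmod (\<phi> x) \<le> norm x * K" "0 \<le> K"
    using bounded_linear.nonneg_bounded[OF assms(1)] by blast
  interpret \<phi>: bounded_linear \<phi> by fact
  define c where "c = (\<lambda>k. cnj (\<phi> (u k)))"
  have bound: "(\<Sum>k\<in>F. (cmod (c k))\<^sup>2) \<le> K\<^sup>2" if F: "finite F" "F \<subseteq> I" for F
  proof -
    define s where "s = (\<Sum>k\<in>F. c k *\<^sub>C u k)"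
    have "\<phi> s = (\<Sum>k\<in>F. c k * cnj (c k))"
      by (simp add: s_def \<phi>.sum assms(2) c_def)
    also have "\<dots> = of_real ((norm s)\<^sup>2)"
      unfolding s_def norm_basis_sum[OF F] by (simp add: complex_norm_square del: of_real_power)
    finally have "(norm s)\<^sup>2 \<le> norm s * K"
      using K(1)[of s] by (simp add: norm_power)
    then have "norm s \<le> K"
      using K(2) by (cases "norm s = 0") (auto simp: power2_eq_square)
    then show ?thesis
      unfolding norm_basis_sum[OF F, symmetric] s_def[symmetric] by (simp add: power_mono)
  qed
  have "(\<lambda>k. (cmod (c k))\<^sup>2) summable_on I"
    by (rule nonneg_bdd_above_summable_on) (auto intro!: bdd_aboveI2[where M = "K\<^sup>2"] bound)
  note coeff = cinner_basis_infsum[OF this]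
  define y where "y = (\<Sum>\<^sub>\<infinity>k\<in>I. c k *\<^sub>C u k)"
  have "\<phi> x = cinner y x" for x
  proof (rule has_sum_unique)
    show "((\<lambda>k. \<phi> (cinner (u k) x *\<^sub>C u k)) has_sum \<phi> x) I"
      by (rule has_sum_bounded_linear[OF assms(1) basis_expansion])
    have "((\<lambda>k. cinner y (cinner (u k) x *\<^sub>C u k)) has_sum cinner y x) I"
      by (rule has_sum_bounded_linear[OF bounded_linear_cinner_right basis_expansion])
    moreover have "cinner y (cinner (u k) x *\<^sub>C u k) = \<phi> (cinner (u k) x *\<^sub>C u k)" if "k \<in> I" for k
    proof -
      have "cinner (u k) y = c k" unfolding y_def by (rule coeff[OF that])
      then have "cinner y (u k) = \<phi> (u k)"
        using cinner_commute[of y "u k"] by (simp add: c_def)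
      then show ?thesis by (simp add: cinner_scaleC_right assms(2))
    qed
    ultimately show "((\<lambda>k. \<phi> (cinner (u k) x *\<^sub>C u k)) has_sum cinner y x) I"
      using has_sum_cong by (metis (no_types, lifting))
  qed
  then show thesis using that by blast
qed

end

section \<open>The index set, the generators and their relations\<close>

text \<open>This form of the index set turns shifts of the indices into arithmetic of natural numbers.\<close>

lemma idx_iff: "(n, i, j) \<in> idx \<longleftrightarrow> n + i \<in> \<nat> \<and> n - i \<in> \<nat> \<and> n + j \<in> \<nat> \<and> n - j \<in> \<nat>"
proof -
  have spin: "i \<in> spins n \<longleftrightarrow> n + i \<in> \<nat> \<and> n - i \<in> \<nat>" if n: "2 * n \<in> \<nat>" for n i :: real
  proof
    assume "i \<in> spins n"
    then obtain k where k: "i = - n + real k" "real k \<le> 2 * n" by (auto simp: spins_def)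
    from n obtain m where m: "2 * n = real m" by (auto elim: Nats_cases)
    with k have "n - i = real (m - k)" by (simp add: of_nat_diff)
    with k show "n + i \<in> \<nat> \<and> n - i \<in> \<nat>" by simp
  next
    assume "n + i \<in> \<nat> \<and> n - i \<in> \<nat>"
    then obtain k l where "n + i = real k" "n - i = real l" by (auto elim!: Nats_cases)
    then show "i \<in> spins n"
      by (auto simp: spins_def intro!: exI[of _ k])
  qed
  have "2 * n \<in> \<nat>" if "n + i \<in> \<nat>" "n - i \<in> \<nat>" for n i :: real
    using Nats_add[OF that] by simp
  then show ?thesis
    using spin by (auto simp: idx_def)
qed

lemma idx_bounds:
  assumes "(n, i, j) \<in> idx"
  shows "0 \<le> n" "\<bar>i\<bar> \<le> n" "\<bar>j\<bar> \<le> n"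
proof -
  have "0 \<le> n + i" "0 \<le> n - i" "0 \<le> n + j" "0 \<le> n - j"
    using assms by (auto simp: idx_iff elim!: Nats_cases)
  then show "0 \<le> n" "\<bar>i\<bar> \<le> n" "\<bar>j\<bar> \<le> n" by linarith+
qed

lemma idx_top: "((real a + real b) / 2, (real a + real b) / 2, (real a - real b) / 2) \<in> idx"
proof -
  have "(real a + real b) / 2 + (real a + real b) / 2 = real (a + b)"
    "(real a + real b) / 2 - (real a + real b) / 2 = real 0"
    "(real a + real b) / 2 + (real a - real b) / 2 = real a"
    "(real a + real b) / 2 - (real a - real b) / 2 = real b"
    by (auto simp: field_simps)
  then show ?thesis unfolding idx_iff by (metis of_nat_in_Nats)
qed

text \<open>Bounded operators \<open>A\<close> and \<open>B\<close> with adjoints \<open>A'\<close> and \<open>B'\<close> that satisfy the relations of the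
  generators \<open>\<alpha>\<close> and \<open>\<beta>\<close> and act on an orthonormal basis by the formulas for left multiplication.\<close>

locale suq2_basis =
  fixes q :: real and A A' B B' :: "'h::chilbert_space \<Rightarrow> 'h"
    and e :: "real \<Rightarrow> real \<Rightarrow> real \<Rightarrow> 'h"
  assumes q_pos: "0 < q" and q_less: "q < 1"
    and relations: "suq2_operator_relations q A A' B B'"
    and orthonormal: "orthonormal_basis e"
    and A_basis: "(n, i, j) \<in> idx \<Longrightarrow> A (e n i j) =
          a_plus q n i j *\<^sub>R basis_or_zero e (n + 1/2) (i - 1/2) (j - 1/2) +
          a_minus q n i j *\<^sub>R basis_or_zero e (n - 1/2) (i - 1/2) (j - 1/2)"
    and B_basis: "(n, i, j) \<in> idx \<Longrightarrow> B (e n i j) =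
          b_plus q n i j *\<^sub>R basis_or_zero e (n + 1/2) (i + 1/2) (j - 1/2) +
          b_minus q n i j *\<^sub>R basis_or_zero e (n - 1/2) (i + 1/2) (j - 1/2)"
begin

sublocale hilbert_basis idx "\<lambda>(n, i, j). e n i j"
proof
  have *: "cinner (e n i j) (e m k l) = (if (n, i, j) = (m, k, l) then 1 else 0)"
    if "(n, i, j) \<in> idx" "(m, k, l) \<in> idx" for n i j m k l
    using orthonormal that unfolding orthonormal_basis_def by blast
  show "cinner (case x of (n, i, j) \<Rightarrow> e n i j) (case y of (n, i, j) \<Rightarrow> e n i j) =
      (if x = y then 1 else 0)" if "x \<in> idx" "y \<in> idx" for x y
    using that by (cases x; cases y) (simp only: * prod.case)
  show "x = 0" if "\<And>k. k \<in> idx \<Longrightarrow> cinner (case k of (n, i, j) \<Rightarrow> e n i j) x = 0" for x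
  proof -
    have "\<forall>(n, i, j)\<in>idx. cinner (e n i j) x = 0" using that by fastforce
    then show ?thesis using orthonormal unfolding orthonormal_basis_def by blast
  qed
qed

lemma clin: "clinear A" "clinear A'" "clinear B" "clinear B'"
  using relations by (auto simp: suq2_operator_relations_def bounded_clinear_def)

lemmas A'_lin = clinearD[OF clin(2)]
lemmas B_lin = clinearD[OF clin(3)]
lemmas B'_lin = clinearD[OF clin(4)]
lemmas A'_pow_lin = clinearD[OF clinear_funpow[OF clin(2)]]
lemmas B_pow_lin = clinearD[OF clinear_funpow[OF clin(3)]]

lemma adjoint_A: "cinner (A x) y = cinner x (A' y)"
  using relations by (auto simp: suq2_operator_relations_def is_adjoint_def)

lemma adjoint_A': "cinner (A' x) y = cinner x (A y)"
  by (metis adjoint_A cinner_commute)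

lemma adjoint_B: "cinner (B x) y = cinner x (B' y)"
  using relations by (auto simp: suq2_operator_relations_def is_adjoint_def)

lemma adjoint_B': "cinner (B' x) y = cinner x (B y)"
  by (metis adjoint_B cinner_commute)

lemma rels: "A' (A x) + B' (B x) = x" "A (A' x) + q\<^sup>2 *\<^sub>R B (B' x) = x"
  "A (B x) = q *\<^sub>R B (A x)" "A (B' x) = q *\<^sub>R B' (A x)" "B' (B x) = B (B' x)"
  using relations by (auto simp: suq2_operator_relations_def)

lemma B_A': "B (A' x) = q *\<^sub>R A' (B x)"
proof (rule cinner_eqI)
  fix z
  have "cinner z (B (A' x)) = cinner (A (B' z)) x"
    by (simp add: adjoint_A adjoint_B')
  also have "\<dots> = cinner z (q *\<^sub>R A' (B x))"
    by (simp add: rels adjoint_A adjoint_B' cinner_scaleR_left cinner_scaleR_right)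
  finally show "cinner z (B (A' x)) = cinner z (q *\<^sub>R A' (B x))" .
qed

lemma B'_A': "B' (A' x) = q *\<^sub>R A' (B' x)"
proof (rule cinner_eqI)
  fix z
  have "cinner z (B' (A' x)) = cinner (A (B z)) x"
    by (simp add: adjoint_A adjoint_B)
  also have "\<dots> = cinner z (q *\<^sub>R A' (B' x))"
    by (simp add: rels adjoint_A adjoint_B cinner_scaleR_left cinner_scaleR_right)
  finally show "cinner z (B' (A' x)) = cinner z (q *\<^sub>R A' (B' x))" .
qed

lemma norm_A'_square: "(norm (A' x))\<^sup>2 = (norm x)\<^sup>2 - q\<^sup>2 * (norm (B' x))\<^sup>2"
proof -
  have "Re (cinner x x) = Re (cinner x (A (A' x) + q\<^sup>2 *\<^sub>R B (B' x)))"
    by (simp only: rels)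
  then show ?thesis
    unfolding norm_square_adjoint[of A' A, OF adjoint_A'] norm_square_adjoint[of B' B, OF adjoint_B']
    by (simp add: cinner_add_right cinner_scaleR_right Re_cinner_self)
qed

lemma norm_A_square: "(norm (A x))\<^sup>2 = (norm x)\<^sup>2 - (norm (B' x))\<^sup>2"
proof -
  have "Re (cinner x x) = Re (cinner x (A' (A x) + B (B' x)))"
    by (simp only: rels flip: rels(5))
  then show ?thesis
    unfolding norm_square_adjoint[of A A', OF adjoint_A] norm_square_adjoint[of B' B, OF adjoint_B']
    by (simp add: cinner_add_right Re_cinner_self)
qed

lemma norm_B_eq: "norm (B x) = norm (B' x)"
proof -
  have "(norm (B x))\<^sup>2 = (norm (B' x))\<^sup>2"
    unfolding norm_square_adjoint[of B B', OF adjoint_B] norm_square_adjoint[of B' B, OF adjoint_B']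
    by (simp only: rels)
  then show ?thesis by simp
qed

lemma norm_B_le: "norm (B x) \<le> norm x"
proof -
  have "(norm (B x))\<^sup>2 \<le> (norm x)\<^sup>2"
    using norm_A_square[of x] zero_le_power2[of "norm (A x)"] by (simp add: norm_B_eq)
  then show ?thesis by (rule power2_le_imp_le) simp
qed

lemma norm_A'_le: "norm (A' x) \<le> norm x"
proof -
  have "(norm (A' x))\<^sup>2 \<le> (norm x)\<^sup>2"
    unfolding norm_A'_square by simp
  then show ?thesis by (rule power2_le_imp_le) simp
qed

lemmas norm_A'_pow_le = norm_funpow_le[of A', OF norm_A'_le]
lemmas norm_B_pow_le = norm_funpow_le[of B, OF norm_B_le]

lemma B'_A'_pow: "B' ((A' ^^ a) x) = q ^ a *\<^sub>R (A' ^^ a) (B' x)"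
  by (induction a) (auto simp: B'_A' A'_lin mult.commute)

lemma B_A'_pow: "B ((A' ^^ a) x) = q ^ a *\<^sub>R (A' ^^ a) (B x)"
  by (induction a) (auto simp: B_A' A'_lin mult.commute)

lemma B_pow_A'_pow: "(B ^^ N) ((A' ^^ a) x) = (q ^ a) ^ N *\<^sub>R (A' ^^ a) ((B ^^ N) x)"
  by (induction N) (auto simp: B_A'_pow B_lin mult.commute)

section \<open>Powers of the adjoint of \<open>\<alpha>\<close> are uniformly bounded below\<close>

text \<open>\<open>qform t a x\<close> is the value at \<open>x\<close> of the quadratic form of the operator
  \<open>(1 - t \<beta> \<beta>*) (1 - t q\<^sup>2 \<beta> \<beta>*) \<cdots> (1 - t q\<^bsup>2(a-1)\<^esup> \<beta> \<beta>*)\<close>.\<close>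

fun qform :: "real \<Rightarrow> nat \<Rightarrow> 'h \<Rightarrow> real" where
  "qform t 0 x = (norm x)\<^sup>2"
| "qform t (Suc a) x = qform t a x - t * q ^ (2 * a) * qform t a (B' x)"

lemma qform_scaleR: "qform t a (r *\<^sub>R x) = r\<^sup>2 * qform t a x"
  by (induction a arbitrary: x) (auto simp: power_mult_distrib B'_lin algebra_simps)

lemma norm_A'_pow_square: "(norm ((A' ^^ a) x))\<^sup>2 = qform (q\<^sup>2) a x"
proof (induction a arbitrary: x)
  case (Suc a)
  have "(norm ((A' ^^ Suc a) x))\<^sup>2 = (norm ((A' ^^ a) x))\<^sup>2 - q\<^sup>2 * (norm (B' ((A' ^^ a) x)))\<^sup>2"
    by (simp add: norm_A'_square)
  also have "\<dots> = qform (q\<^sup>2) (Suc a) x"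
    by (simp add: Suc B'_A'_pow power_mult_distrib power_even_eq flip: power_mult)
  finally show ?case .
qed simp

text \<open>Since \<open>1 - \<beta> \<beta>* = \<alpha>* \<alpha>\<close> and \<open>\<alpha> \<beta>* = q \<beta>* \<alpha>\<close>, passing from \<open>x\<close> to \<open>\<beta>* x\<close> lowers the form by another
  form of this kind. This yields the lower bound by induction on \<open>a\<close>, simultaneously for all
  \<open>t \<in> [0, 1]\<close>, without the functional calculus of \<open>\<beta> \<beta>*\<close>.\<close>

lemma qform_diff: "qform t a x - qform t a (B' x) = qform (t * q\<^sup>2) a (A x)"
proof (induction a arbitrary: x)
  case 0
  show ?case by (simp add: norm_A_square)
next
  case (Suc a)
  have "qform t (Suc a) x - qform t (Suc a) (B' x) =
      (qform t a x - qform t a (B' x)) - t * q ^ (2 * a) * (qform t a (B' x) - qform t a (B' (B' x)))"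
    by (simp add: algebra_simps)
  also have "\<dots> = qform (t * q\<^sup>2) (Suc a) (A x)"
    by (simp only: Suc) (simp add: rels qform_scaleR)
  finally show ?case .
qed

lemma qform_ge:
  assumes "0 \<le> t" "t \<le> 1"
  shows "(\<Prod>l<a. 1 - t * q ^ (2 * l)) * (norm x)\<^sup>2 \<le> qform t a x"
  using assms
proof (induction a arbitrary: t x)
  case (Suc a)
  have le1: "s * q ^ (2 * l) \<le> 1" if "0 \<le> s" "s \<le> 1" for s l
    using that q_pos q_less by (intro mult_le_one) (auto intro: power_le_one)
  have nonneg: "0 \<le> qform s a y" if "0 \<le> s" "s \<le> 1" for s y
  proof -
    have "0 \<le> (\<Prod>l<a. 1 - s * q ^ (2 * l)) * (norm y)\<^sup>2"
      using le1[OF that] by (intro mult_nonneg_nonneg prod_nonneg) auto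
    also have "\<dots> \<le> qform s a y" by (rule Suc.IH[OF that])
    finally show ?thesis .
  qed
  have "0 \<le> qform (t * q\<^sup>2) a (A x)"
    using Suc.prems le1[of t 1] q_pos by (intro nonneg) auto
  then have "qform t a (B' x) \<le> qform t a x"
    using qform_diff[of t a x] by simp
  then have "t * q ^ (2 * a) * qform t a (B' x) \<le> t * q ^ (2 * a) * qform t a x"
    using Suc.prems q_pos by (intro mult_left_mono) auto
  then have "(1 - t * q ^ (2 * a)) * qform t a x \<le> qform t (Suc a) x"
    by (simp add: algebra_simps)
  moreover have "(1 - t * q ^ (2 * a)) * ((\<Prod>l<a. 1 - t * q ^ (2 * l)) * (norm x)\<^sup>2)
      \<le> (1 - t * q ^ (2 * a)) * qform t a x"
    using le1[of t a] Suc by (intro mult_left_mono) auto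
  ultimately show ?case by (simp add: mult_ac)
qed simp

lemma norm_A'_pow_ge:
  obtains r where "0 < r" "\<And>a x. r * norm x \<le> norm ((A' ^^ a) x)"
proof -
  have "0 < q\<^sup>2" "q\<^sup>2 < 1"
    using q_pos q_less by (auto simp: power_less_one_iff)
  then obtain \<rho> where \<rho>: "0 < \<rho>" "\<And>a. \<rho> \<le> (\<Prod>l<a. 1 - q\<^sup>2 * (q\<^sup>2) ^ l)"
    using prod_one_minus_powers_ge by blast
  have "sqrt \<rho> * norm x \<le> norm ((A' ^^ a) x)" for a x
  proof -
    have "(sqrt \<rho> * norm x)\<^sup>2 = \<rho> * (norm x)\<^sup>2"
      using \<rho>(1) by (simp add: power_mult_distrib)
    also have "\<dots> \<le> (\<Prod>l<a. 1 - q\<^sup>2 * q ^ (2 * l)) * (norm x)\<^sup>2"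
      using \<rho>(2)[of a] by (intro mult_right_mono) (auto simp: power_mult)
    also have "\<dots> \<le> (norm ((A' ^^ a) x))\<^sup>2"
      unfolding norm_A'_pow_square using \<open>q\<^sup>2 < 1\<close> by (intro qform_ge) auto
    finally show ?thesis by (rule power2_le_imp_le) simp
  qed
  with \<rho>(1) show thesis by (intro that[of "sqrt \<rho>"]) auto
qed

section \<open>The row of basis vectors with \<open>i = n\<close>\<close>

text \<open>The cyclic unit vector.\<close>

definition \<Omega> :: 'h where "\<Omega> = e 0 0 0"

text \<open>The vector \<open>\<alpha>*\<^sup>a \<beta>\<^sup>b \<Omega>\<close>. Up to nonzero scalars these are the basis vectors with \<open>i = n\<close>, where
  \<open>a = n + j\<close> and \<open>b = n - j\<close>.\<close>

definition top_vec :: "nat \<Rightarrow> nat \<Rightarrow> 'h" where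
  "top_vec a b = (A' ^^ a) ((B ^^ b) \<Omega>)"

lemma q_pow_less: "0 < n \<Longrightarrow> q ^ n < 1"
  using q_pos q_less by (simp add: power_less_one_iff)

lemma cinner_basis_or_zero:
  assumes "(n, i, j) \<in> idx"
  shows "cinner (basis_or_zero e m k l) (e n i j) = (if (m, k, l) = (n, i, j) then 1 else 0)"
  using ortho[OF _ assms, of "(m, k, l)"] assms by (auto simp: basis_or_zero_def)

lemma basis_or_zero_outside: "(n, i, j) \<notin> idx \<Longrightarrow> basis_or_zero e n i j = 0"
  by (simp add: basis_or_zero_def)

lemma basis_or_zero_inside: "(n, i, j) \<in> idx \<Longrightarrow> basis_or_zero e n i j = e n i j"
  by (simp add: basis_or_zero_def)

lemma basis_eqI3:
  "(\<And>n i j. (n, i, j) \<in> idx \<Longrightarrow> cinner (e n i j) x = cinner (e n i j) y) \<Longrightarrow> x = y"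
  by (rule basis_eqI) auto

lemma idx_raise:
  assumes "(n, n, j) \<in> idx"
  shows "(n + 1/2, n + 1/2, j + 1/2) \<in> idx" "(n + 1/2, n + 1/2, j - 1/2) \<in> idx"
proof -
  have *: "n + 1/2 + (n + 1/2) = n + n + 1" "n + 1/2 - (n + 1/2) = 0"
    "n + 1/2 + (j + 1/2) = n + j + 1" "n + 1/2 - (j + 1/2) = n - j"
    "n + 1/2 + (j - 1/2) = n + j" "n + 1/2 - (j - 1/2) = n - j + 1"
    by auto
  show "(n + 1/2, n + 1/2, j + 1/2) \<in> idx" "(n + 1/2, n + 1/2, j - 1/2) \<in> idx"
    using assms unfolding idx_iff * by (auto intro: Nats_add)
qed

lemma A'_top:
  assumes "(n, n, j) \<in> idx"
  shows "A' (e n n j) = a_minus q (n + 1/2) (n + 1/2) (j + 1/2) *\<^sub>R e (n + 1/2) (n + 1/2) (j + 1/2)"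
proof (rule basis_eqI3)
  fix m k l assume mkl: "(m, k, l) \<in> idx"
  let ?e = "e (n + 1/2) (n + 1/2) (j + 1/2)"
  \<comment> \<open>this excludes the contribution of \<open>a\<^sub>+\<close>, which would need \<open>k = m + 1\<close>\<close>
  have "k \<le> m" using idx_bounds[OF mkl] by simp
  have "cinner (e m k l) (A' (e n n j)) = cinner (A (e m k l)) (e n n j)"
    by (simp add: adjoint_A)
  also have "\<dots> =
      of_real (a_plus q m k l) * (if (m + 1/2, k - 1/2, l - 1/2) = (n, n, j) then 1 else 0) +
      of_real (a_minus q m k l) * (if (m - 1/2, k - 1/2, l - 1/2) = (n, n, j) then 1 else 0)"
    by (simp only: A_basis[OF mkl] cinner_add_left cinner_scaleR_left cinner_basis_or_zero[OF assms])
  also have "\<dots> = (if (m, k, l) = (n + 1/2, n + 1/2, j + 1/2)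
      then of_real (a_minus q (n + 1/2) (n + 1/2) (j + 1/2)) else 0)"
    using \<open>k \<le> m\<close> by auto
  also have "\<dots> = cinner (e m k l) (a_minus q (n + 1/2) (n + 1/2) (j + 1/2) *\<^sub>R ?e)"
    using ortho[OF mkl idx_raise(1)[OF assms]] by (auto simp: cinner_scaleR_right)
  finally show "cinner (e m k l) (A' (e n n j)) =
      cinner (e m k l) (a_minus q (n + 1/2) (n + 1/2) (j + 1/2) *\<^sub>R ?e)" .
qed

lemma B_top:
  assumes "(n, n, j) \<in> idx"
  shows "B (e n n j) = b_plus q n n j *\<^sub>R e (n + 1/2) (n + 1/2) (j - 1/2)"
proof -
  have "(n - 1/2, n + 1/2, j - 1/2) \<notin> idx"
    using idx_bounds(2)[of "n - 1/2" "n + 1/2" "j - 1/2"] by auto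
  then show ?thesis
    by (simp add: B_basis[OF assms] basis_or_zero_outside basis_or_zero_inside idx_raise(2)[OF assms])
qed

lemma a_minus_top_nonzero:
  assumes "(n, n, j) \<in> idx"
  shows "a_minus q (n + 1/2) (n + 1/2) (j + 1/2) \<noteq> 0"
proof -
  have "q powr t < 1" if "0 < t" for t
    using that q_pos q_less powr01_less_one by blast
  then have "q powr (2 * (n + 1/2) + 2 * (j + 1/2)) < 1" "q powr (2 * (n + 1/2) + 2 * (n + 1/2)) < 1"
    "q powr (4 * (n + 1/2)) < 1" "q powr (4 * (n + 1/2) + 2) < 1"
    using idx_bounds[OF assms] by auto
  then show ?thesis
    unfolding a_minus_def by (simp only: real_sqrt_eq_zero_cancel_iff divide_eq_0_iff mult_eq_0_iff) simp
qed

lemma b_plus_bottom_square: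
  "(b_plus q (real b / 2) (real b / 2) (- (real b / 2)))\<^sup>2 = (1 - q ^ (2 * b + 2)) / (1 - q ^ (2 * b + 4))"
proof -
  have *: "q powr (4 * (real b / 2) + 2) = q ^ (2 * b + 2)" "q powr (4 * (real b / 2) + 4) = q ^ (2 * b + 4)"
    using powr_realpow[OF q_pos, of "2 * b + 2"] powr_realpow[OF q_pos, of "2 * b + 4"]
    by (simp_all add: add.commute)
  have lt: "q ^ (2 * b + 2) < 1" "q ^ (2 * b + 4) < 1"
    by (rule q_pow_less, simp)+
  have "(b_plus q (real b / 2) (real b / 2) (- (real b / 2)))\<^sup>2 =
      (1 - q ^ (2 * b + 2)) * (1 - q ^ (2 * b + 2)) / ((1 - q ^ (2 * b + 2)) * (1 - q ^ (2 * b + 4)))"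
    using lt q_pos unfolding b_plus_def power2_minus *[symmetric]
    by (subst real_sqrt_pow2) (auto simp: powr_realpow[symmetric])
  also have "\<dots> = (1 - q ^ (2 * b + 2)) / (1 - q ^ (2 * b + 4))"
    using lt by simp
  finally show ?thesis .
qed

text \<open>The product of the coefficients \<open>b\<^sub>+\<close> telescopes, so \<open>\<parallel>\<beta>\<^sup>b \<Omega>\<parallel>\<close> stays away from \<open>0\<close>.\<close>

lemma B_pow_\<Omega>:
  obtains \<kappa> :: real where "(B ^^ b) \<Omega> = \<kappa> *\<^sub>R e (real b / 2) (real b / 2) (- (real b / 2))"
    "\<kappa>\<^sup>2 = (1 - q\<^sup>2) / (1 - q ^ (2 * b + 2))"
proof (induction b arbitrary: thesis)
  case 0
  have "q\<^sup>2 < 1" using q_pos q_less by (simp add: power_less_one_iff)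
  then show ?case using 0[of 1] by (simp add: \<Omega>_def power2_eq_square)
next
  case (Suc b)
  then obtain \<kappa> where \<kappa>: "(B ^^ b) \<Omega> = \<kappa> *\<^sub>R e (real b / 2) (real b / 2) (- (real b / 2))"
    "\<kappa>\<^sup>2 = (1 - q\<^sup>2) / (1 - q ^ (2 * b + 2))" by blast
  let ?\<kappa>' = "\<kappa> * b_plus q (real b / 2) (real b / 2) (- (real b / 2))"
  have idx: "(real b / 2, real b / 2, - (real b / 2)) \<in> idx"
    using idx_top[of 0 b] by simp
  have "(B ^^ Suc b) \<Omega> = ?\<kappa>' *\<^sub>R e (real b / 2 + 1/2) (real b / 2 + 1/2) (- (real b / 2) - 1/2)"
    by (simp add: \<kappa> B_lin B_top[OF idx])
  moreover have "real b / 2 + 1/2 = real (Suc b) / 2" "- (real b / 2) - 1/2 = - (real (Suc b) / 2)"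
    by (auto simp: field_simps)
  ultimately have "(B ^^ Suc b) \<Omega> = ?\<kappa>' *\<^sub>R e (real (Suc b) / 2) (real (Suc b) / 2) (- (real (Suc b) / 2))"
    by metis
  moreover have "q ^ (2 * b + 2) < 1"
    by (rule q_pow_less) simp
  then have "?\<kappa>'\<^sup>2 = (1 - q\<^sup>2) / (1 - q ^ (2 * Suc b + 2))"
    unfolding power_mult_distrib \<kappa>(2) b_plus_bottom_square by (simp add: eval_nat_numeral)
  ultimately show ?case using Suc.prems by blast
qed

lemma norm_B_pow_\<Omega>_ge: "sqrt (1 - q\<^sup>2) \<le> norm ((B ^^ b) \<Omega>)"
proof -
  obtain \<kappa> where \<kappa>: "(B ^^ b) \<Omega> = \<kappa> *\<^sub>R e (real b / 2) (real b / 2) (- (real b / 2))"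
    "\<kappa>\<^sup>2 = (1 - q\<^sup>2) / (1 - q ^ (2 * b + 2))" using B_pow_\<Omega> by blast
  have lt: "q ^ (2 * b + 2) < 1" "q\<^sup>2 < 1"
    by (rule q_pow_less, simp)+
  have "norm (e (real b / 2) (real b / 2) (- (real b / 2))) = 1"
    using norm_basis[OF idx_top[of 0 b]] by simp
  then have "(norm ((B ^^ b) \<Omega>))\<^sup>2 = \<kappa>\<^sup>2"
    by (simp add: \<kappa>(1))
  moreover have "1 - q\<^sup>2 \<le> (1 - q\<^sup>2) / (1 - q ^ (2 * b + 2))"
    using lt q_pos mult_left_le[of "1 - q ^ (2 * b + 2)" "1 - q\<^sup>2"]
    by (simp add: le_divide_eq del: power_Suc)
  ultimately show ?thesis
    by (intro real_le_lsqrt) (auto simp: \<kappa>(2))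
qed

lemma top_vec_eq:
  obtains \<kappa> :: real where "\<kappa> \<noteq> 0" "\<kappa>\<^sup>2 \<le> 1"
    "top_vec a b = \<kappa> *\<^sub>R e ((real a + real b) / 2) ((real a + real b) / 2) ((real a - real b) / 2)"
proof -
  have "\<exists>\<kappa>::real. \<kappa> \<noteq> 0 \<and>
    top_vec a b = \<kappa> *\<^sub>R e ((real a + real b) / 2) ((real a + real b) / 2) ((real a - real b) / 2)"
  proof (induction a)
    case 0
    obtain \<kappa> where \<kappa>: "(B ^^ b) \<Omega> = \<kappa> *\<^sub>R e (real b / 2) (real b / 2) (- (real b / 2))"
      "\<kappa>\<^sup>2 = (1 - q\<^sup>2) / (1 - q ^ (2 * b + 2))" using B_pow_\<Omega> by blast
    have "\<kappa> \<noteq> 0"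
    proof
      assume "\<kappa> = 0"
      then have "norm ((B ^^ b) \<Omega>) = 0" using \<kappa>(1) by simp
      moreover have "q\<^sup>2 < 1" using q_pos q_less by (simp add: power_less_one_iff)
      ultimately show False
        using norm_B_pow_\<Omega>_ge[of b] by (metis diff_gt_0_iff_gt not_less real_sqrt_gt_0_iff)
    qed
    with \<kappa>(1) show ?case by (auto simp: top_vec_def)
  next
    case (Suc a)
    let ?n = "(real a + real b) / 2" and ?j = "(real a - real b) / 2"
    obtain \<kappa> where \<kappa>: "\<kappa> \<noteq> 0" "top_vec a b = \<kappa> *\<^sub>R e ?n ?n ?j" using Suc by blast
    let ?a = "a_minus q (?n + 1/2) (?n + 1/2) (?j + 1/2)"
    have "top_vec (Suc a) b = A' (top_vec a b)" by (simp add: top_vec_def)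
    also have "\<dots> = (\<kappa> * ?a) *\<^sub>R e (?n + 1/2) (?n + 1/2) (?j + 1/2)"
      by (simp add: \<kappa>(2) A'_lin A'_top[OF idx_top])
    finally have "\<exists>\<kappa>'. \<kappa>' \<noteq> 0 \<and> top_vec (Suc a) b = \<kappa>' *\<^sub>R e (?n + 1/2) (?n + 1/2) (?j + 1/2)"
      using \<kappa>(1) a_minus_top_nonzero[OF idx_top[of a b]] by (metis mult_eq_0_iff)
    moreover have "?n + 1/2 = (real (Suc a) + real b) / 2" "?j + 1/2 = (real (Suc a) - real b) / 2"
      by (simp_all add: field_simps)
    ultimately show ?case by (simp only:)
  qed
  then obtain \<kappa> :: real where \<kappa>: "\<kappa> \<noteq> 0"
    "top_vec a b = \<kappa> *\<^sub>R e ((real a + real b) / 2) ((real a + real b) / 2) ((real a - real b) / 2)"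
    by blast
  have n1: "norm (e ((real a + real b) / 2) ((real a + real b) / 2) ((real a - real b) / 2)) = 1"
    "norm \<Omega> = 1"
    using norm_basis[OF idx_top[of a b]] norm_basis[OF idx_top[of 0 0]] by (auto simp: \<Omega>_def)
  have "norm (top_vec a b) \<le> norm ((B ^^ b) \<Omega>)"
    unfolding top_vec_def by (rule norm_A'_pow_le)
  also have "\<dots> \<le> 1"
    using norm_B_pow_le[of b \<Omega>] n1 by simp
  finally have "\<bar>\<kappa>\<bar> \<le> 1" using n1 by (simp add: \<kappa>(2))
  then have "\<kappa>\<^sup>2 \<le> 1" by (simp add: abs_square_le_1)
  with \<kappa> show thesis using that by blast
qed

section \<open>Vectors whose translates approach the top row\<close>

text \<open>The indices of the top row.\<close>

definition top_idx :: "(real \<times> real \<times> real) set" where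
  "top_idx = {(n, i, j). i = n}"

text \<open>The indices of a joint weight space: \<open>\<alpha>*\<close> raises the first weight \<open>i + j\<close> by \<open>1\<close> and preserves
  the second weight \<open>i - j\<close>.\<close>

definition weight_idx :: "real \<Rightarrow> real \<Rightarrow> (real \<times> real \<times> real) set" where
  "weight_idx s d = {(n, i, j). i + j = s \<and> i - j = d}"

lemma cinner_basis_proj3:
  assumes "(n, i, j) \<in> idx"
  shows "cinner (e n i j) (proj S x) = (if (n, i, j) \<in> S then cinner (e n i j) x else 0)"
  using cinner_basis_proj[OF assms] by simp

lemma cinner_basis_or_zero_proj:
  "cinner (basis_or_zero e n i j) (proj S x) =
    (if (n, i, j) \<in> S then cinner (basis_or_zero e n i j) x else 0)"
  by (simp add: basis_or_zero_def cinner_basis_proj3)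

lemma A'_weight: "A' (proj (weight_idx s d) x) = proj (weight_idx (s + 1) d) (A' x)"
proof (rule basis_eqI3)
  fix n i j assume nij: "(n, i, j) \<in> idx"
  have *: "(m, i - 1/2, j - 1/2) \<in> weight_idx s d \<longleftrightarrow> (n, i, j) \<in> weight_idx (s + 1) d" for m
    by (auto simp: weight_idx_def)
  have eA: "cinner (e n i j) (A' y) =
      of_real (a_plus q n i j) * cinner (basis_or_zero e (n + 1/2) (i - 1/2) (j - 1/2)) y +
      of_real (a_minus q n i j) * cinner (basis_or_zero e (n - 1/2) (i - 1/2) (j - 1/2)) y" for y
    by (simp only: adjoint_A[symmetric] A_basis[OF nij] cinner_add_left cinner_scaleR_left)
  show "cinner (e n i j) (A' (proj (weight_idx s d) x)) =
      cinner (e n i j) (proj (weight_idx (s + 1) d) (A' x))"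
    unfolding cinner_basis_proj3[OF nij] eA cinner_basis_or_zero_proj * by simp
qed

lemma A'_pow_weight:
  "(A' ^^ a) (proj (weight_idx s d) x) = proj (weight_idx (s + real a) d) ((A' ^^ a) x)"
  by (induction a) (auto simp: A'_weight add_ac)

text \<open>The weight \<open>(p, b)\<close> occurs only once in the top row, and not at all if \<open>b < 0\<close>.\<close>

lemma top_weight_proj:
  "\<exists>c. proj top_idx (proj (weight_idx (real p) (real b)) x) = c *\<^sub>C top_vec p b"
proof -
  let ?n = "(real p + real b) / 2" and ?j = "(real p - real b) / 2"
  obtain \<kappa> where \<kappa>: "\<kappa> \<noteq> 0" "top_vec p b = \<kappa> *\<^sub>R e ?n ?n ?j"
    using top_vec_eq by metis
  have single: "l = (?n, ?n, ?j)" if l: "l \<in> top_idx \<inter> weight_idx (real p) (real b)" for l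
  proof -
    obtain n i j where nij: "l = (n, i, j)" by (cases l)
    with l have "i = n" "real p = n + j" "real b = n - j"
      by (auto simp: top_idx_def weight_idx_def)
    with nij show ?thesis by simp
  qed
  have mem: "(?n, ?n, ?j) \<in> top_idx \<inter> weight_idx (real p) (real b)"
    by (simp add: top_idx_def weight_idx_def flip: add_divide_distrib diff_divide_distrib)
  have "proj (top_idx \<inter> weight_idx (real p) (real b)) x = cinner (e ?n ?n ?j) x *\<^sub>C e ?n ?n ?j"
    using proj_singleton[OF single idx_top mem] by simp
  also have "\<dots> = (cinner (e ?n ?n ?j) x / of_real \<kappa>) *\<^sub>C top_vec p b"
    using \<kappa> by (simp add: scaleC_of_real[symmetric] scaleC_scaleC)
  finally show ?thesis by (metis proj_proj)
qed

lemma top_weight_proj_negative: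
  assumes "d < 0"
  shows "proj top_idx (proj (weight_idx s d) x) = 0"
proof (rule basis_eqI3)
  fix n i j assume nij: "(n, i, j) \<in> idx"
  then have "(n, i, j) \<notin> top_idx \<inter> weight_idx s d"
    using idx_bounds[OF nij] assms by (auto simp: top_idx_def weight_idx_def)
  then show "cinner (e n i j) (proj top_idx (proj (weight_idx s d) x)) = cinner (e n i j) 0"
    by (auto simp: cinner_basis_proj3[OF nij])
qed

text \<open>The key step: a vector is orthogonal to all basis vectors with \<open>i \<noteq> n\<close> if its translates under
  powers of \<open>\<alpha>*\<close> approach the top row at the rate \<open>1 / (a + 1)\<close>.\<close>

lemma top_if_translates_decay:
  assumes decay: "\<And>a. norm (proj (- top_idx) ((A' ^^ a) x)) \<le> C / (real a + 1)"
    and idx0: "(n0, i0, j0) \<in> idx" and not_top: "i0 \<noteq> n0"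
  shows "cinner (e n0 i0 j0) x = 0"
proof -
  obtain r where r: "0 < r" "\<And>a x. r * norm x \<le> norm ((A' ^^ a) x)"
    using norm_A'_pow_ge by blast
  define s where "s = i0 + j0"
  define d where "d = i0 - j0"
  define y where "y = proj (weight_idx s d) x"
  have y0: "cinner (e n0 i0 j0) y = cinner (e n0 i0 j0) x"
    by (simp add: y_def cinner_basis_proj3[OF idx0] weight_idx_def s_def d_def)
  have y_weight: "proj (weight_idx (s + real a) d) ((A' ^^ a) y) = (A' ^^ a) y" for a
    by (simp add: y_def A'_pow_weight proj_proj)
  have y_decay: "norm ((A' ^^ a) y - proj top_idx ((A' ^^ a) y)) \<le> C / (real a + 1)" for a
  proof -
    have "(A' ^^ a) y - proj top_idx ((A' ^^ a) y) = proj (- top_idx) ((A' ^^ a) y)"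
      using proj_complement[of "(A' ^^ a) y" top_idx] by (simp add: algebra_simps)
    also have "\<dots> = proj (weight_idx (s + real a) d) (proj (- top_idx) ((A' ^^ a) x))"
      unfolding y_def A'_pow_weight proj_proj by (simp add: Int_commute)
    finally have "norm ((A' ^^ a) y - proj top_idx ((A' ^^ a) y)) \<le> norm (proj (- top_idx) ((A' ^^ a) x))"
      by (simp only: norm_proj_le)
    then show ?thesis using decay[of a] by (rule order_trans)
  qed
  show ?thesis
  proof (cases "d < 0")
    case True
    have "r * norm y \<le> C / (real a + 1)" for a :: nat
    proof -
      have "proj top_idx ((A' ^^ a) y) = 0"
        using top_weight_proj_negative[OF True] y_weight[of a] by metis
      then show ?thesis
        using y_decay[of a] r(2)[of y a] by simp
    qed
    then have "r * norm y \<le> 0" by (rule nonpos_if_le_harmonic)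
    then have "y = 0" using r(1) by (simp add: mult_le_0_iff)
    then show ?thesis using y0 by simp
  next
    case False
    obtain k1 k2 k3 :: nat where k: "n0 + i0 = real k1" "n0 - i0 = real k2" "n0 - j0 = real k3"
      using idx0 by (auto simp: idx_iff elim!: Nats_cases)
    then have "d = real k3 - real k2" "s = real k1 - real k3"
      by (auto simp: d_def s_def)
    moreover from this have "k2 \<le> k3" using False by simp
    ultimately obtain b where b: "d = real b" using that[of "k3 - k2"] by (simp add: of_nat_diff)
    show ?thesis
    proof (cases "k3 \<le> k1")
      case True
      then obtain m where m: "s = real m"
        using that[of "k1 - k3"] \<open>s = real k1 - real k3\<close> by (simp add: of_nat_diff)
      \<comment> \<open>cancelling \<open>\<alpha>*\<^sup>a\<close>, the vector \<open>y\<close> is close to a multiple of \<open>\<alpha>*\<^sup>m \<beta>\<^sup>b \<Omega>\<close>\<close>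
      have "r * cmod (cinner (e n0 i0 j0) y) \<le> C / (real a + 1)" for a :: nat
      proof -
        have "proj (weight_idx (real (a + m)) (real b)) ((A' ^^ a) y) = (A' ^^ a) y"
          using y_weight[of a] by (simp add: b m add.commute)
        then obtain c where c: "proj top_idx ((A' ^^ a) y) = c *\<^sub>C top_vec (a + m) b"
          using top_weight_proj by metis
        have "(A' ^^ a) y - proj top_idx ((A' ^^ a) y) = (A' ^^ a) (y - c *\<^sub>C top_vec m b)"
          unfolding c by (simp add: A'_pow_lin top_vec_def funpow_add)
        then have "r * norm (y - c *\<^sub>C top_vec m b) \<le> C / (real a + 1)"
          using r(2)[of "y - c *\<^sub>C top_vec m b" a] y_decay[of a] by simp
        moreover have "cinner (e n0 i0 j0) (top_vec m b) = 0"
        proof -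
          obtain \<kappa> where "top_vec m b =
              \<kappa> *\<^sub>R e ((real m + real b) / 2) ((real m + real b) / 2) ((real m - real b) / 2)"
            using top_vec_eq by metis
          then show ?thesis
            using ortho[OF idx0 idx_top[of m b]] not_top by (auto simp: cinner_scaleR_right)
        qed
        then have "cmod (cinner (e n0 i0 j0) y) \<le> norm (y - c *\<^sub>C top_vec m b)"
          using cinner_Cauchy_Schwarz[of "e n0 i0 j0" "y - c *\<^sub>C top_vec m b"] norm_basis[OF idx0]
          by (simp add: cinner_diff_right cinner_scaleC_right)
        ultimately show ?thesis
          using r(1) by (smt (verit) mult_left_mono)
      qed
      then have "r * cmod (cinner (e n0 i0 j0) y) \<le> 0" by (rule nonpos_if_le_harmonic)
      then have "cmod (cinner (e n0 i0 j0) y) = 0" using r(1) by (simp add: mult_le_0_iff)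
      then show ?thesis using y0 by simp
    next
      case False
      define m where "m = k3 - k1"
      have m: "s = - real m" "0 < m"
        using False \<open>s = real k1 - real k3\<close> by (auto simp: m_def of_nat_diff)
      define z where "z = (A' ^^ m) y"
      define K where "K = C / r * (1 + 1 / sqrt (1 - q\<^sup>2))"
      have q2: "0 < sqrt (1 - q\<^sup>2)" using q_pos q_less by (simp add: power_less_one_iff)
      have C: "0 \<le> C" using norm_ge_zero decay[of 0] by (metis add_0 div_by_1 of_nat_0 order_trans)
      \<comment> \<open>\<open>z\<close> is close to some \<open>c \<beta>\<^sup>b \<Omega>\<close>; applying \<open>\<beta>\<^sup>N\<close> shows that \<open>c\<close> is small\<close>
      have "norm z \<le> K / (real a + 1)" for a :: nat
      proof -
        have iter: "(A' ^^ (a + m)) y = (A' ^^ a) z"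
          by (simp add: z_def funpow_add)
        have "proj (weight_idx (real a) (real b)) ((A' ^^ a) z) = (A' ^^ a) z"
          using y_weight[of "a + m"] unfolding iter by (simp add: b m)
        then obtain c where c: "proj top_idx ((A' ^^ a) z) = c *\<^sub>C top_vec a b"
          using top_weight_proj by metis
        define w where "w = z - c *\<^sub>C (B ^^ b) \<Omega>"
        have "(A' ^^ a) z - proj top_idx ((A' ^^ a) z) = (A' ^^ a) w"
          unfolding c w_def by (simp add: A'_pow_lin top_vec_def)
        then have "r * norm w \<le> C / (real (a + m) + 1)"
          using r(2)[of w a] y_decay[of "a + m"] unfolding iter by simp
        also have "\<dots> \<le> C / (real a + 1)"
          using C by (intro divide_left_mono) auto
        finally have "norm w \<le> C / (real a + 1) / r"
          using r(1) by (subst pos_le_divide_eq) (simp_all add: mult.commute)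
        then have w: "norm w \<le> C / r / (real a + 1)"
          by (simp only: divide_divide_eq_left mult.commute)
        have "cmod c * sqrt (1 - q\<^sup>2) \<le> norm w + q ^ N * norm y" for N
        proof -
          have "cmod c * sqrt (1 - q\<^sup>2) \<le> norm (c *\<^sub>C (B ^^ (N + b)) \<Omega>)"
            unfolding norm_scaleC_hilbert by (intro mult_left_mono norm_B_pow_\<Omega>_ge) auto
          also have "c *\<^sub>C (B ^^ (N + b)) \<Omega> = (B ^^ N) z - (B ^^ N) w"
            by (simp add: w_def B_pow_lin funpow_add)
          also have "norm \<dots> \<le> norm ((B ^^ N) z) + norm ((B ^^ N) w)"
            by (rule norm_triangle_ineq4)
          also have "norm ((B ^^ N) w) \<le> norm w" by (rule norm_B_pow_le)
          also have "norm ((B ^^ N) z) = (q ^ m) ^ N * norm ((A' ^^ m) ((B ^^ N) y))"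
            using q_pos by (simp add: z_def B_pow_A'_pow)
          also have "\<dots> \<le> q ^ N * norm y"
          proof (rule mult_mono)
            have "q ^ m \<le> q ^ 1"
              using q_pos q_less m(2) by (intro power_decreasing) auto
            then show "(q ^ m) ^ N \<le> q ^ N"
              using q_pos by (intro power_mono) auto
            show "norm ((A' ^^ m) ((B ^^ N) y)) \<le> norm y"
              using norm_A'_pow_le norm_B_pow_le order_trans by blast
          qed (use q_pos in auto)
          finally show ?thesis by simp
        qed
        then have "cmod c * sqrt (1 - q\<^sup>2) \<le> norm w"
          by (rule le_if_le_geometric) (use q_pos q_less in simp_all)
        then have c_le: "cmod c \<le> norm w / sqrt (1 - q\<^sup>2)"
          using q2 by (simp add: field_simps)
        have "norm z \<le> norm w + norm (c *\<^sub>C (B ^^ b) \<Omega>)"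
          using norm_triangle_ineq[of w "c *\<^sub>C (B ^^ b) \<Omega>"] by (simp add: w_def)
        also have "norm (c *\<^sub>C (B ^^ b) \<Omega>) \<le> cmod c * norm \<Omega>"
          unfolding norm_scaleC_hilbert by (intro mult_left_mono norm_B_pow_le) auto
        also have "norm \<Omega> = 1"
          using norm_basis[OF idx_top[of 0 0]] by (simp add: \<Omega>_def)
        also have "norm w + cmod c * 1 \<le> norm w * (1 + 1 / sqrt (1 - q\<^sup>2))"
          using c_le by (simp add: algebra_simps)
        also have "\<dots> \<le> C / r / (real a + 1) * (1 + 1 / sqrt (1 - q\<^sup>2))"
          using w q2 by (intro mult_right_mono) auto
        also have "\<dots> = K / (real a + 1)" by (simp add: K_def)
        finally show ?thesis by simp
      qed
      then have "norm z \<le> 0" by (rule nonpos_if_le_harmonic)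
      then have "r * norm y \<le> 0" using r(2)[of y m] by (simp add: z_def)
      then have "y = 0" using r(1) by (simp add: mult_le_0_iff)
      then show ?thesis using y0 by simp
    qed
  qed
qed

section \<open>The Dirac operator and its commutators\<close>

lemma ortho3:
  "(n, i, j) \<in> idx \<Longrightarrow> (m, k, l) \<in> idx \<Longrightarrow>
    cinner (e n i j) (e m k l) = (if (n, i, j) = (m, k, l) then 1 else 0)"
  using ortho[of "(n, i, j)" "(m, k, l)"] by (simp only: prod.case)

lemma cinner_basis_dirac:
  assumes "x \<in> dirac_domain e" "(n, i, j) \<in> idx"
  shows "cinner (e n i j) (dirac e x) = of_real (dirac_eigenvalue n i) * cinner (e n i j) x"
proof -
  let ?c = "\<lambda>(n, i, j). of_real (dirac_eigenvalue n i) * cinner (e n i j) x"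
  have "(\<lambda>k. (cmod (?c k))\<^sup>2) =
      (\<lambda>(n, i, j). (dirac_eigenvalue n i * cmod (cinner (e n i j) x))\<^sup>2)"
    by (auto simp: norm_mult power_mult_distrib)
  then have "(\<lambda>k. (cmod (?c k))\<^sup>2) summable_on idx"
    using assms(1) by (simp add: dirac_domain_def)
  from cinner_basis_infsum[OF this assms(2)]
  show ?thesis
    unfolding dirac_def by (simp add: case_prod_unfold)
qed

lemma dirac_domain_if_finite_support:
  assumes "finite F" "\<And>n i j. (n, i, j) \<in> idx \<Longrightarrow> (n, i, j) \<notin> F \<Longrightarrow> cinner (e n i j) x = 0"
  shows "x \<in> dirac_domain e"
  unfolding dirac_domain_def
proof (rule CollectI, rule finite_nonzero_values_imp_summable_on)
  show "finite {k \<in> idx. (case k of (n, i, j) \<Rightarrow>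
      (dirac_eigenvalue n i * cmod (cinner (e n i j) x))\<^sup>2) \<noteq> 0}"
    by (rule finite_subset[OF _ assms(1)]) (use assms(2) in fastforce)
qed

lemma basis_in_dirac_domain: "(n, i, j) \<in> idx \<Longrightarrow> e n i j \<in> dirac_domain e"
  by (rule dirac_domain_if_finite_support[of "{(n, i, j)}"]) (simp_all only: ortho3, auto)

lemma dirac_basis:
  assumes "(n, i, j) \<in> idx"
  shows "dirac e (e n i j) = dirac_eigenvalue n i *\<^sub>R e n i j"
proof (rule basis_eqI3)
  fix m k l assume mkl: "(m, k, l) \<in> idx"
  show "cinner (e m k l) (dirac e (e n i j)) = cinner (e m k l) (dirac_eigenvalue n i *\<^sub>R e n i j)"
    using ortho[OF mkl assms]
    by (simp add: cinner_basis_dirac[OF basis_in_dirac_domain[OF assms] mkl] cinner_scaleR_right)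
qed

lemma proj_in_dirac_domain: "finite F \<Longrightarrow> proj F x \<in> dirac_domain e"
  by (rule dirac_domain_if_finite_support[of F]) (auto simp: cinner_basis_proj3)

lemma cinner_proj_self: "cinner x (proj S x) = of_real ((norm (proj S x))\<^sup>2)"
proof -
  have "cinner (proj (- S) x) (proj S x) = 0"
    by (rule cinner_eq_0_if_coefficients) (auto simp: cinner_basis_proj3)
  then have "cinner x (proj S x) = cinner (proj S x) (proj S x)"
    using proj_complement[of x S] cinner_add_left[of "proj S x" "proj (- S) x" "proj S x"] by simp
  then show ?thesis by (simp only: cinner_self)
qed

text \<open>On the complement of the top row the Dirac operator is positive.\<close>

lemma inner_dirac_proj_nonneg:
  assumes "finite F" "F \<inter> top_idx = {}"
  shows "0 \<le> inner x (dirac e (proj F x))"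
proof (rule has_sum_nonneg)
  let ?u = "\<lambda>k. case k of (n, i, j) \<Rightarrow> e n i j"
  show "((\<lambda>k. inner x (cinner (?u k) (dirac e (proj F x)) *\<^sub>C ?u k)) has_sum
      inner x (dirac e (proj F x))) idx"
    by (rule has_sum_bounded_linear[OF bounded_linear_inner_right basis_expansion])
  fix k assume k: "k \<in> idx"
  obtain n i j where nij: "k = (n, i, j)" by (cases k)
  have d: "0 \<le> dirac_eigenvalue n i" if "(n, i, j) \<in> F"
    using that assms(2) idx_bounds[of n i j] k nij by (auto simp: dirac_eigenvalue_def top_idx_def)
  have "cinner x (cinner (e n i j) x *\<^sub>C e n i j) = of_real ((cmod (cinner (e n i j) x))\<^sup>2)"
    by (metis cinner_commute cinner_scaleC_right complex_norm_square)
  then have "inner x (cinner (e n i j) x *\<^sub>C e n i j) = (cmod (cinner (e n i j) x))\<^sup>2"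
    by (metis Re_cinner Re_complex_of_real)
  then show "0 \<le> inner x (cinner (?u k) (dirac e (proj F x)) *\<^sub>C ?u k)"
    using k d
    by (simp add: nij cinner_basis_dirac[OF proj_in_dirac_domain[OF assms(1)]] cinner_basis_proj3
        scaleC_scaleC[symmetric] scaleC_of_real)
qed

lemma adjoint_A_pow: "cinner ((A' ^^ a) x) y = cinner x ((A ^^ a) y)"
  by (induction a arbitrary: x) (auto simp: funpow_swap1 adjoint_A')

text \<open>This permits truncations to finitely many basis vectors, which lie in the domain of the
  Dirac operator.\<close>

lemma proj_norm_le_if_finite:
  assumes "\<And>F. finite F \<Longrightarrow> norm (proj (F \<inter> S) x) \<le> K" "0 \<le> K"
  shows "norm (proj S x) \<le> K"
proof -
  have "(norm (proj S x))\<^sup>2 \<le> K\<^sup>2"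
  proof (rule has_sum_le_finite_sums[OF Parseval])
    fix F assume F: "finite F" "F \<subseteq> idx"
    have "(\<Sum>k\<in>F. (cmod (cinner (case k of (n, i, j) \<Rightarrow> e n i j) (proj S x)))\<^sup>2) =
        (\<Sum>k\<in>F. (cmod (cinner (case k of (n, i, j) \<Rightarrow> e n i j) (proj (F \<inter> S) x)))\<^sup>2)"
      by (rule sum.cong) (use F in \<open>auto simp: cinner_basis_proj3\<close>)
    also have "\<dots> \<le> (norm (proj (F \<inter> S) x))\<^sup>2" by (rule Bessel[OF F])
    also have "\<dots> \<le> K\<^sup>2" using assms(1)[OF F(1)] by (simp add: power_mono)
    finally show "(\<Sum>k\<in>F. (cmod (cinner (case k of (n, i, j) \<Rightarrow> e n i j) (proj S x)))\<^sup>2) \<le> K\<^sup>2" .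
  qed
  then show ?thesis by (rule power2_le_imp_le) (rule assms(2))
qed

text \<open>For a unit vector \<open>v\<close> with \<open>D v = -(a + 1) v\<close> the coefficients of \<open>[D, T] v\<close> are those of \<open>T v\<close>
  multiplied by \<open>d + a + 1\<close>, where \<open>d > 0\<close> outside the top row.\<close>

lemma commutator_decay:
  assumes T: "bounded_clinear T" and TA': "\<And>x. T (A' x) = A' (T x)"
    and dom: "\<And>x. x \<in> dirac_domain e \<Longrightarrow> T x \<in> dirac_domain e"
    and C: "\<And>x. x \<in> dirac_domain e \<Longrightarrow> norm (dirac e (T x) - T (dirac e x)) \<le> C * norm x"
  shows "norm (proj (- top_idx) ((A' ^^ a) (T \<Omega>))) \<le> C / (real a + 1)"
proof -
  note T_lin = clinearD[OF T[unfolded bounded_clinear_def, THEN conjunct1]]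
  let ?n = "(real a + real 0) / 2" and ?j = "(real a - real 0) / 2"
  note v_idx = idx_top[of a 0]
  define v where "v = e ?n ?n ?j"
  obtain \<kappa> where \<kappa>: "\<kappa>\<^sup>2 \<le> 1" "top_vec a 0 = \<kappa> *\<^sub>R v"
    using top_vec_eq[of a 0] unfolding v_def by metis
  have v_dom: "v \<in> dirac_domain e" and v_norm: "norm v = 1"
    using basis_in_dirac_domain[OF v_idx] norm_basis[OF v_idx] by (simp_all add: v_def)
  define w where "w = dirac e (T v) - T (dirac e v)"
  have w: "norm w \<le> C" using C[OF v_dom] v_norm by (simp add: w_def)
  have Dv: "dirac e v = - (real a + 1) *\<^sub>R v"
    unfolding v_def dirac_basis[OF v_idx] by (simp add: dirac_eigenvalue_def)
  have TDv: "T (dirac e v) = - (real a + 1) *\<^sub>R T v"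
    by (simp only: Dv T_lin)
  have "norm ((real a + 1) *\<^sub>R proj (- top_idx) (T v)) \<le> norm w"
  proof (rule norm_le_if_coefficients_le)
    fix k assume k: "k \<in> idx"
    obtain n i j where nij: "k = (n, i, j)" by (cases k)
    have "cinner (e n i j) w =
        of_real (dirac_eigenvalue n i + (real a + 1)) * cinner (e n i j) (T v)"
      by (simp only: w_def TDv cinner_diff_right cinner_scaleR_right
          cinner_basis_dirac[OF dom[OF v_dom] k[unfolded nij]]) (simp add: algebra_simps)
    moreover have "real a + 1 \<le> dirac_eigenvalue n i + (real a + 1)" if "i \<noteq> n"
      using that idx_bounds[of n i j] k by (simp add: nij dirac_eigenvalue_def)
    ultimately show "cmod (cinner (case k of (n, i, j) \<Rightarrow> e n i j)
        ((real a + 1) *\<^sub>R proj (- top_idx) (T v))) \<le> cmod (cinner (case k of (n, i, j) \<Rightarrow> e n i j) w)"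
      using k by (auto simp: nij cinner_scaleR_right cinner_basis_proj3 top_idx_def norm_mult
          simp del: of_real_add intro!: mult_right_mono)
  qed
  then have "(real a + 1) * norm (proj (- top_idx) (T v)) \<le> C"
    using w by simp
  then have Tv: "norm (proj (- top_idx) (T v)) \<le> C / (real a + 1)"
    by (simp add: pos_le_divide_eq mult.commute)
  have "(A' ^^ a) (T \<Omega>) = T (top_vec a 0)"
    using funpow_commute[of T A' a \<Omega>] TA' by (simp add: top_vec_def)
  also have "\<dots> = of_real \<kappa> *\<^sub>C T v"
    by (simp add: \<kappa>(2) T_lin scaleC_of_real)
  finally have "norm (proj (- top_idx) ((A' ^^ a) (T \<Omega>))) = \<bar>\<kappa>\<bar> * norm (proj (- top_idx) (T v))"
    by (simp add: proj_scaleC norm_scaleC_hilbert)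
  also have "\<dots> \<le> norm (proj (- top_idx) (T v))"
    using \<kappa>(1) by (simp add: abs_square_le_1 mult_left_le_one_le)
  finally show ?thesis using Tv by linarith
qed

text \<open>The corresponding statement for \<open>\<eta> = T* \<Omega>\<close>. It is not assumed that \<open>T*\<close> preserves the domain of \<open>D\<close>, so
  \<open>\<langle>v, [D, T] z\<rangle>\<close> is estimated for finite truncations \<open>z\<close> of \<open>(1 - P) \<alpha>*\<^sup>a \<eta>\<close>.\<close>

lemma adjoint_commutator_decay:
  assumes T: "bounded_clinear T" and TA: "\<And>x. T (A x) = A (T x)"
    and dom: "\<And>x. x \<in> dirac_domain e \<Longrightarrow> T x \<in> dirac_domain e"
    and C: "\<And>x. x \<in> dirac_domain e \<Longrightarrow> norm (dirac e (T x) - T (dirac e x)) \<le> C * norm x" "0 \<le> C"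
    and \<eta>: "\<And>x. cinner \<Omega> (T x) = cinner \<eta> x"
  shows "norm (proj (- top_idx) ((A' ^^ a) \<eta>)) \<le> C / (real a + 1)"
proof (rule proj_norm_le_if_finite)
  show "0 \<le> C / (real a + 1)" using C(2) by simp
  fix F :: "(real \<times> real \<times> real) set" assume F: "finite F"
  let ?n = "(real a + real 0) / 2" and ?j = "(real a - real 0) / 2"
  note v_idx = idx_top[of a 0]
  define v where "v = e ?n ?n ?j"
  obtain \<kappa> where \<kappa>: "\<kappa>\<^sup>2 \<le> 1" "top_vec a 0 = \<kappa> *\<^sub>R v"
    using top_vec_eq[of a 0] unfolding v_def by metis
  define x where "x = (A' ^^ a) \<eta>"
  define S where "S = F \<inter> - top_idx"
  have S: "finite S" "S \<inter> top_idx = {}" using F by (auto simp: S_def)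
  define z where "z = proj S x"
  have z_dom: "z \<in> dirac_domain e" unfolding z_def by (rule proj_in_dirac_domain[OF S(1)])
  have x: "cinner x y = of_real \<kappa> * cinner v (T y)" for y
  proof -
    have "cinner x y = cinner \<Omega> (T ((A ^^ a) y))"
      by (simp add: x_def adjoint_A_pow \<eta>)
    also have "\<dots> = cinner (top_vec a 0) (T y)"
      using funpow_commute[of T A a y] TA by (simp add: top_vec_def adjoint_A_pow)
    finally show ?thesis by (simp add: \<kappa>(2) cinner_scaleR_left)
  qed
  define w where "w = dirac e (T z) - T (dirac e z)"
  have w: "norm w \<le> C * norm z" unfolding w_def by (rule C(1)[OF z_dom])
  have "cinner v (dirac e (T z)) = of_real (- (real a + 1)) * cinner v (T z)"
    unfolding v_def cinner_basis_dirac[OF dom[OF z_dom] v_idx] by (simp add: dirac_eigenvalue_def)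
  then have "of_real \<kappa> * cinner v w =
      of_real \<kappa> * (of_real (- (real a + 1)) * cinner v (T z) - cinner v (T (dirac e z)))"
    by (simp only: w_def cinner_diff_right)
  then have "of_real \<kappa> * cinner v w = - (of_real (real a + 1) * cinner x z + cinner x (dirac e z))"
    unfolding x by (simp add: algebra_simps)
  then have "Re (of_real \<kappa> * cinner v w) = - ((real a + 1) * (norm z)\<^sup>2 + inner x (dirac e z))"
    unfolding z_def cinner_proj_self by (simp add: Re_cinner[symmetric] flip: of_real_power)
  then have "(real a + 1) * (norm z)\<^sup>2 \<le> - Re (of_real \<kappa> * cinner v w)"
    using inner_dirac_proj_nonneg[OF S, of x] by (simp add: z_def)
  also have "\<dots> \<le> cmod (of_real \<kappa> * cinner v w)"
    using abs_Re_le_cmod[of "of_real \<kappa> * cinner v w"] by linarith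
  also have "\<dots> = \<bar>\<kappa>\<bar> * cmod (cinner v w)" by (simp add: norm_mult)
  also have "\<dots> \<le> cmod (cinner v w)"
    using \<kappa>(1) by (simp add: abs_square_le_1 mult_left_le_one_le)
  also have "\<dots> \<le> norm w"
    using cinner_Cauchy_Schwarz[of v w] norm_basis[OF v_idx] by (simp add: v_def)
  also have "\<dots> \<le> C * norm z" by (rule w)
  finally have "((real a + 1) * norm z) * norm z \<le> C * norm z"
    by (simp add: power2_eq_square mult.assoc)
  then have "(real a + 1) * norm z \<le> C"
    using C(2) by (cases "z = 0") auto
  then show "norm (proj (F \<inter> - top_idx) ((A' ^^ a) \<eta>)) \<le> C / (real a + 1)"
    unfolding S_def[symmetric] x_def[symmetric] z_def[symmetric]
    by (simp add: pos_le_divide_eq mult.commute)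
qed

section \<open>The commutant\<close>

text \<open>Membership in the top row, as the vanishing of all other coefficients.\<close>

definition top_supported :: "'h \<Rightarrow> bool" where
  "top_supported x \<longleftrightarrow> (\<forall>n i j. (n, i, j) \<in> idx \<longrightarrow> i \<noteq> n \<longrightarrow> cinner (e n i j) x = 0)"

lemma top_supportedD:
  assumes "top_supported x" "i \<noteq> n \<or> (n, i, j) \<notin> idx"
  shows "cinner (basis_or_zero e n i j) x = 0"
  using assms by (auto simp: top_supported_def basis_or_zero_def)

text \<open>The case \<open>n = 0\<close> says that \<open>\<alpha>*\<close>, and below \<open>\<beta>\<close>, map the top row into the orthogonal complement
  of \<open>\<Omega>\<close>.\<close>

lemma cinner_A'_top_supported:
  assumes x: "top_supported x" and nij: "(n, i, j) \<in> idx" and "i \<noteq> n \<or> n = 0"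
  shows "cinner (e n i j) (A' x) = 0"
proof -
  have "i \<le> n" "0 \<le> n" using idx_bounds[OF nij] by auto
  have "i - 1/2 \<noteq> n + 1/2" using \<open>i \<le> n\<close> by simp
  moreover have "i - 1/2 \<noteq> n - 1/2 \<or> (n - 1/2, i - 1/2, j - 1/2) \<notin> idx"
    using assms(3) idx_bounds(1)[of "n - 1/2" "i - 1/2" "j - 1/2"] by auto
  ultimately have "cinner (basis_or_zero e (n + 1/2) (i - 1/2) (j - 1/2)) x = 0"
    "cinner (basis_or_zero e (n - 1/2) (i - 1/2) (j - 1/2)) x = 0"
    by (auto intro!: top_supportedD[OF x])
  then show ?thesis
    by (simp only: adjoint_A[symmetric] A_basis[OF nij] cinner_add_left cinner_scaleR_left) simp
qed

lemma cinner_B_top_supported: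
  assumes x: "top_supported x" and nij: "(n, i, j) \<in> idx" and "i \<noteq> n \<or> n = 0"
  shows "cinner (e n i j) (B x) = 0"
proof -
  have "cinner (B' (e n i j)) x = 0"
  proof (rule cinner_eq_0_if_coefficients)
    fix k assume k: "k \<in> idx"
    obtain m k' l where mkl: "k = (m, k', l)" by (cases k)
    show "cinner (case k of (n, i, j) \<Rightarrow> e n i j) (B' (e n i j)) = 0 \<or>
        cinner (case k of (n, i, j) \<Rightarrow> e n i j) x = 0"
    proof (cases "k' = m")
      case True
      then have idx: "(m, m, l) \<in> idx" using k mkl by simp
      have "(m + 1/2, m + 1/2, l - 1/2) \<noteq> (n, i, j)"
        using assms(3) idx_bounds(1)[OF idx] by auto
      then have "cinner (e m m l) (B' (e n i j)) = 0"
        by (simp only: adjoint_B[symmetric] B_top[OF idx] cinner_scaleR_left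
            ortho3[OF idx_raise(2)[OF idx] nij]) simp
      then show ?thesis by (simp add: mkl True)
    next
      case False
      then show ?thesis using x k by (auto simp: mkl top_supported_def)
    qed
  qed
  then show ?thesis by (simp add: adjoint_B')
qed

lemma top_supported_A': "top_supported x \<Longrightarrow> top_supported (A' x)"
  using cinner_A'_top_supported by (simp add: top_supported_def[of "A' x"])

lemma top_supported_B: "top_supported x \<Longrightarrow> top_supported (B x)"
  using cinner_B_top_supported by (simp add: top_supported_def[of "B x"])

lemma \<Omega>_orthogonal_translate:
  assumes x: "top_supported x" and ab: "a \<noteq> 0 \<or> b \<noteq> 0"
  shows "cinner \<Omega> ((A' ^^ a) ((B ^^ b) x)) = 0"
proof -
  have idx0: "(0, 0, 0) \<in> idx" using idx_top[of 0 0] by simp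
  have B: "top_supported ((B ^^ b) x)" for b
    by (induction b) (auto simp: x top_supported_B)
  have A: "top_supported ((A' ^^ a) ((B ^^ b) x))" for a
    by (induction a) (auto simp: B top_supported_A')
  show ?thesis
  proof (cases a)
    case (Suc a')
    then show ?thesis
      using cinner_A'_top_supported[OF A[of a'] idx0] by (simp add: \<Omega>_def)
  next
    case 0
    with ab obtain b' where "b = Suc b'" by (cases b) auto
    then show ?thesis
      using 0 cinner_B_top_supported[OF B[of b'] idx0] by (simp add: \<Omega>_def)
  qed
qed

text \<open>Hence \<open>T* \<Omega>\<close> is a multiple of \<open>\<Omega>\<close>; the vector is obtained from the Riesz representation theorem.\<close>

lemma commutant_vector_functional:
  assumes T: "bounded_clinear T"
    and TA: "\<And>x. T (A x) = A (T x)" and TA': "\<And>x. T (A' x) = A' (T x)"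
    and TB: "\<And>x. T (B x) = B (T x)"
    and comm: "bounded_commutator (dirac_domain e) (dirac e) T"
  obtains c where "\<And>x. cinner \<Omega> (T x) = c * cinner \<Omega> x"
proof -
  have T_clin: "clinear T" and T_bdd: "bounded_linear T"
    using T by (auto simp: bounded_clinear_def)
  note T_lin = clinearD[OF T_clin]
  have dom: "T x \<in> dirac_domain e" if "x \<in> dirac_domain e" for x
    using comm that by (auto simp: bounded_commutator_def)
  obtain C where C: "\<And>x. x \<in> dirac_domain e \<Longrightarrow> norm (dirac e (T x) - T (dirac e x)) \<le> C * norm x"
    using comm by (auto simp: bounded_commutator_def)
  have idx0: "(0, 0, 0) \<in> idx" using idx_top[of 0 0] by simp
  have "0 \<le> C * norm (e 0 0 0)"
    using C[OF basis_in_dirac_domain[OF idx0]] norm_ge_zero order_trans by blast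
  then have C0: "0 \<le> C" using norm_basis[OF idx0] by simp
  have "bounded_linear (\<lambda>x. cinner \<Omega> (T x))"
    using bounded_linear_compose[OF bounded_linear_cinner_right T_bdd] by (simp add: o_def)
  then obtain \<eta> where \<eta>: "\<And>x. cinner \<Omega> (T x) = cinner \<eta> x"
    using Riesz_representation[of "\<lambda>x. cinner \<Omega> (T x)"] by (auto simp: T_lin cinner_scaleC_right)
  have \<xi>_top: "top_supported (T \<Omega>)"
    unfolding top_supported_def
    using top_if_translates_decay[OF commutator_decay[OF T TA' dom C]] by blast
  have \<eta>_top: "top_supported \<eta>"
    unfolding top_supported_def
    using top_if_translates_decay[OF adjoint_commutator_decay[OF T TA dom C C0 \<eta>]] by blast
  have "cinner (e n i j) \<eta> = 0" if nij: "(n, i, j) \<in> idx" "(n, i, j) \<noteq> (0, 0, 0)" for n i j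
  proof (cases "i = n")
    case False
    then show ?thesis using \<eta>_top nij(1) by (auto simp: top_supported_def)
  next
    case True
    obtain a b :: nat where ab: "n + j = real a" "n - j = real b"
      using nij(1) by (auto simp: idx_iff elim!: Nats_cases)
    then have n: "(real a + real b) / 2 = n" "(real a - real b) / 2 = j" by auto
    obtain \<kappa> where \<kappa>: "\<kappa> \<noteq> 0" "top_vec a b = \<kappa> *\<^sub>R e n n j"
      using top_vec_eq[of a b] unfolding n by metis
    have "a \<noteq> 0 \<or> b \<noteq> 0" using n nij(2) True by auto
    then have "cinner \<Omega> ((A' ^^ a) ((B ^^ b) (T \<Omega>))) = 0"
      by (rule \<Omega>_orthogonal_translate[OF \<xi>_top])
    moreover have "T (top_vec a b) = (A' ^^ a) ((B ^^ b) (T \<Omega>))"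
      using funpow_commute[of T A' a] funpow_commute[of T B b] TA' TB by (simp add: top_vec_def)
    ultimately have "cinner \<eta> (top_vec a b) = 0" by (metis \<eta>)
    then have "cinner \<eta> (e n n j) = 0" using \<kappa> by (simp add: cinner_scaleR_right)
    then show ?thesis using True cinner_commute[of "e n n j" \<eta>] by simp
  qed
  then have "\<eta> = cinner \<Omega> \<eta> *\<^sub>C \<Omega>"
    using ortho[OF _ idx0]
    by (intro basis_eqI3) (fastforce simp: \<Omega>_def cinner_scaleC_right)
  then have "cinner \<eta> x = cnj (cinner \<Omega> \<eta>) * cinner \<Omega> x" for x
    by (metis cinner_scaleC_left)
  with \<eta> show thesis using that[of "cnj (cinner \<Omega> \<eta>)"] by simp
qed

end

lemma suq2_operator_relations_representation:
  assumes rep: "star_representation \<pi>" and rel: "suq2_relations q \<alpha> \<beta>"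
  shows "suq2_operator_relations q (\<pi> \<alpha>) (\<pi> (star \<alpha>)) (\<pi> \<beta>) (\<pi> (star \<beta>))"
proof -
  have mult: "\<pi> a (\<pi> b x) = \<pi> (a * b) x" for a b x
    using rep by (simp add: star_representation_def)
  have scale: "r *\<^sub>R \<pi> a x = \<pi> (r *\<^sub>R a) x" for r a x
    using rep by (simp add: star_representation_def flip: scaleC_of_real)
  have add: "\<pi> a x + \<pi> b x = \<pi> (a + b) x" for a b x
    using rep by (simp add: star_representation_def)
  have one: "\<pi> 1 x = x" for x
    using rep by (simp add: star_representation_def)
  have ops: "is_adjoint (\<pi> a) (\<pi> (star a))" "bounded_clinear (\<pi> a)" for a
    using rep by (auto simp: star_representation_def)
  have "star \<alpha> * \<alpha> + star \<beta> * \<beta> = 1" "\<alpha> * star \<alpha> + q\<^sup>2 *\<^sub>R (\<beta> * star \<beta>) = 1"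
    "\<alpha> * \<beta> = q *\<^sub>R (\<beta> * \<alpha>)" "\<alpha> * star \<beta> = q *\<^sub>R (star \<beta> * \<alpha>)" "star \<beta> * \<beta> = \<beta> * star \<beta>"
    using rel unfolding suq2_relations_def by blast+
  note r = this
  show ?thesis
    unfolding suq2_operator_relations_def mult scale add r(1-4)
    by (simp only: ops one r(5) simp_thms)
qed

theorem corollary4p10:
  fixes q :: real
    and \<alpha> \<beta> :: "'a::cstar_algebra"
    and h :: "'a \<Rightarrow> complex"
    and \<pi> :: "'a \<Rightarrow> 'h::chilbert_space \<Rightarrow> 'h"
    and \<Lambda> :: "'a \<Rightarrow> 'h"
    and e :: "real \<Rightarrow> real \<Rightarrow> real \<Rightarrow> 'h"
    and T :: "'h \<Rightarrow> 'h"
  assumes "0 < q" and "q < 1"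
    and "universal_suq2 q \<alpha> \<beta>"
    and "haar_state q \<alpha> \<beta> h"
    and "gns h \<pi> \<Lambda>"
    and "canonical_basis q \<alpha> \<beta> \<pi> \<Lambda> e"
    and "T \<in> commutant (range \<pi>)"
    and "bounded_commutator (dirac_domain e) (dirac e) T"
  shows "\<exists>c :: complex. \<forall>x. T x = c *\<^sub>C x"
proof -
  have rep: "star_representation \<pi>" and dense: "closure (range \<Lambda>) = UNIV"
    and \<pi>\<Lambda>: "\<And>a b. \<pi> a (\<Lambda> b) = \<Lambda> (a * b)"
    using assms(5) by (auto simp: gns_def)
  have basis: "orthonormal_basis e" "e 0 0 0 = \<Lambda> 1"
    "\<And>n i j. (n, i, j) \<in> idx \<Longrightarrow> \<pi> \<alpha> (e n i j) =
          a_plus q n i j *\<^sub>R basis_or_zero e (n + 1/2) (i - 1/2) (j - 1/2) +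
          a_minus q n i j *\<^sub>R basis_or_zero e (n - 1/2) (i - 1/2) (j - 1/2)"
    "\<And>n i j. (n, i, j) \<in> idx \<Longrightarrow> \<pi> \<beta> (e n i j) =
          b_plus q n i j *\<^sub>R basis_or_zero e (n + 1/2) (i + 1/2) (j - 1/2) +
          b_minus q n i j *\<^sub>R basis_or_zero e (n - 1/2) (i + 1/2) (j - 1/2)"
    using assms(6) unfolding canonical_basis_def by blast+
  have rels: "suq2_operator_relations q (\<pi> \<alpha>) (\<pi> (star \<alpha>)) (\<pi> \<beta>) (\<pi> (star \<beta>))"
    using assms(3) rep by (simp add: universal_suq2_def suq2_operator_relations_representation)
  interpret suq2_basis q "\<pi> \<alpha>" "\<pi> (star \<alpha>)" "\<pi> \<beta>" "\<pi> (star \<beta>)" e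
    by (rule suq2_basis.intro) (fact assms(1,2) rels basis)+
  have T: "bounded_clinear T" and T_comm: "\<And>a x. T (\<pi> a x) = \<pi> a (T x)"
    using assms(7) by (auto simp: commutant_def o_def fun_eq_iff)
  obtain c where c: "\<And>x. cinner \<Omega> (T x) = c * cinner \<Omega> x"
    using commutant_vector_functional[OF T T_comm T_comm T_comm assms(8)] by blast
  have "T x = c *\<^sub>C x" for x
  proof -
    let ?z = "T x - c *\<^sub>C x"
    have "cinner ?z (\<Lambda> a) = 0" for a
    proof -
      have \<Lambda>a: "\<Lambda> a = \<pi> a \<Omega>" by (simp add: \<Omega>_def basis(2) \<pi>\<Lambda>)
      have adj: "cinner (\<pi> a \<Omega>) y = cinner \<Omega> (\<pi> (star a) y)" for y
        using rep by (auto simp: star_representation_def is_adjoint_def)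
      have "cinner (\<Lambda> a) (T x) = c * cinner (\<Lambda> a) x"
        unfolding \<Lambda>a adj T_comm[symmetric] c ..
      then have "cinner (\<Lambda> a) ?z = 0"
        by (simp add: cinner_diff_right cinner_scaleC_right)
      then show ?thesis using cinner_commute[of ?z "\<Lambda> a"] by simp
    qed
    moreover have "closed {y. cinner ?z y = 0}"
      by (intro closed_Collect_eq continuous_on_const
          linear_continuous_on bounded_linear_cinner_right)
    ultimately have "closure (range \<Lambda>) \<subseteq> {y. cinner ?z y = 0}"
      by (intro closure_minimal) auto
    then have "cinner ?z ?z = 0" using dense by blast
    then show ?thesis by (simp add: cinner_self)
  qed
  then show ?thesis by blast
qed
end
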